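(* Let $M$ be a smooth Banach manifold and let $S$ be a semispray on $M$. Then its iterated complete lift $S^{c_\infty}=\varprojlim S^{c_i}$ is a semispray on $T^\infty M$.
   Context: All maps and manifolds are smooth; $M$ is a Banach manifold modeled on a Banach space $\mathbb{E}$ and admits smooth partitions of unity ("partitionable"). $T^0M=M$, $T^rM=T(T^{r-1}M)$, and $\pi_r:T^{r+1}M\to T^rM$ is the tangent bundle projection. $D$ denotes the tangent map, $D^2=DD$. $\mathfrak{X}(N)$ is the set of vector fields (smooth sections of $TN\to N$). Atlas: for an atlas $\{(U_\alpha,\phi_\alpha)\}$ of $M$, put $\phi_{\alpha_0}=\phi_\alpha$, $U_{\alpha_0}=U_\alpha$, $U_{\alpha_r}=\pi_{r-1}^{-1}(U_{\alpha_{r-1}})$, $\phi_{\alpha_r}=D\phi_{\alpha_{r-1}}$; these are charts of $T^rM$ with model space $\mathbb{E}_r=\mathbb{E}^{2^r}$. Canonical involution: $\kappa_1=\mathrm{id}_{TM}$, and for $r\ge 2$, $\kappa_r:T^rM\to T^rM$ is the diffeomorphism with $\partial_t\partial_s\gamma(t,s)=\kappa_r\partial_s\partial_t\gamma(t,s)$ for every smooth $\gamma:(-\epsilon,\epsilon)^2\to T^{r-2}M$; in charts $\kappa_r(x,y,X,Y)=(x,X,y,Y)$. Complete lift: for a vector field $\mathbf{A}:T^rM\to T^{r+1}M$ ($r\ge0$), $\mathbf{A}^c=D\kappa_{r+1}\circ\kappa_{r+2}\circ D\mathbf{A}\circ\kappa_{r+1}:T^{r+1}M\to T^{r+2}M$,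 a vector field on $T^{r+1}M$. For $S\in\mathfrak{X}(TM)$: $S^{c_0}=S$, $S^{c_j}=(S^{c_{j-1}})^c:T(T^jM)\to T^2(T^jM)$. Semisprays: for $r\ge1$, a semispray on $T^{r-1}M$ is a vector field $S:T^rM\to T^{r+1}M$ with $\kappa_{r+1}\circ S=S$, equivalently $D\pi_{r-1}\circ S=\mathrm{id}_{T^rM}$. A semispray on $T^\infty M$ is a vector field $S$ on $TT^\infty M$ with $D\pi_{T^\infty M}\circ S=\mathrm{id}_{TT^\infty M}$, where $\pi_{T^\infty M}=\varprojlim\pi_i:TT^\infty M\to T^\infty M$ is the tangent bundle projection. $T^\infty M$: the projective limit $\varprojlim T^iM$ of the system $\{T^iM\}_{i\in\mathbb{N}}$ with connecting maps $\pi_i:T^{i+1}M\to T^iM$. It is a (generalized) Fréchet manifold modeled on $\mathbb{E}_\infty=\varprojlim\mathbb{E}_i$ (connecting maps $\mathbb{E}_{i+1}=\mathbb{E}_i^2\to\mathbb{E}_i$, $(x,y)\mapsto x$), with charts $(\varprojlim U_{\alpha_i},\varprojlim\phi_{\alpha_i})$. Its tangent bundles are identified with projective limits: $TT^\infty M=\varprojlim\{T(T^iM),D\pi_i\}$ and $T^2(T^\infty M)=\varprojlim\{T^2(T^iM),D^2\pi_i\}$. For a vector field $S$ on $TM$, $S^{c_\infty}=\varprojlim S^{c_i}:TT^\infty M\to T^2(T^\infty M)$, $(\xi_i)_i\mapsto(S^{c_i}(\xi_i))_i$. *)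

theory Defs
  imports "HOL-Analysis.Analysis" "HOL-Analysis.Finite_Function_Topology"
begin

section \<open>The model spaces of the iterated tangent bundles\<close>

text \<open>
  All spaces \<open>E_r = E^(2^r)\<close> have to live in one HOL type, because \<open>r\<close> is quantified over.
  We use finitely supported sequences with their (\<open>l\<^sup>1\<close>) norm: \<open>E_r\<close> is the closed
  subspace of those supported in \<open>{0..<2^r}\<close>, and the splitting \<open>E_(r+1) = E_r \<times> E_r\<close> is
  first half / second half of the coordinates.
\<close>

definition E_space :: "nat \<Rightarrow> (nat \<Rightarrow>\<^sub>0 'e::real_normed_vector) set" where
  "E_space r = {x. \<forall>n\<ge>2 ^ r. Poly_Mapping.lookup x n = 0}"

definition E_fst :: "nat \<Rightarrow> (nat \<Rightarrow>\<^sub>0 'e::real_normed_vector) \<Rightarrow> (nat \<Rightarrow>\<^sub>0 'e)" where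
  "E_fst r z = (\<Sum>n<2 ^ r. Poly_Mapping.single n (Poly_Mapping.lookup z n))"

definition E_snd :: "nat \<Rightarrow> (nat \<Rightarrow>\<^sub>0 'e::real_normed_vector) \<Rightarrow> (nat \<Rightarrow>\<^sub>0 'e)" where
  "E_snd r z = (\<Sum>n<2 ^ r. Poly_Mapping.single n (Poly_Mapping.lookup z (2 ^ r + n)))"

definition E_pair :: "nat \<Rightarrow> (nat \<Rightarrow>\<^sub>0 'e::real_normed_vector) \<Rightarrow> (nat \<Rightarrow>\<^sub>0 'e) \<Rightarrow> (nat \<Rightarrow>\<^sub>0 'e)" where
  "E_pair r x y =
     (\<Sum>n<2 ^ r. Poly_Mapping.single n (Poly_Mapping.lookup x n)
               + Poly_Mapping.single (2 ^ r + n) (Poly_Mapping.lookup y n))"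

text \<open>\<open>(x, y, X, Y) \<mapsto> (x, X, y, Y)\<close> on \<open>E_(r+2) = (E_r \<times> E_r) \<times> (E_r \<times> E_r)\<close>.\<close>

definition E_flip :: "nat \<Rightarrow> (nat \<Rightarrow>\<^sub>0 'e::real_normed_vector) \<Rightarrow> (nat \<Rightarrow>\<^sub>0 'e)" where
  "E_flip r z =
     E_pair (Suc r)
       (E_pair r (E_fst r (E_fst (Suc r) z)) (E_fst r (E_snd (Suc r) z)))
       (E_pair r (E_snd r (E_fst (Suc r) z)) (E_snd r (E_snd (Suc r) z)))"


section \<open>Smoothness between Banach spaces\<close>

text \<open>The tangent map \<open>(x, v) \<mapsto> (f x, Df(x) v)\<close> of \<open>f\<close> from (an open subset of) \<open>E_r\<close> to \<open>F_s\<close>.\<close>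

definition E_tangent ::
  "nat \<Rightarrow> nat \<Rightarrow> ((nat \<Rightarrow>\<^sub>0 'e::real_normed_vector) \<Rightarrow> (nat \<Rightarrow>\<^sub>0 'f::real_normed_vector))
     \<Rightarrow> (nat \<Rightarrow>\<^sub>0 'e) \<Rightarrow> (nat \<Rightarrow>\<^sub>0 'f)" where
  "E_tangent r s f z =
     E_pair s (f (E_fst r z)) (frechet_derivative f (at (E_fst r z) within E_space r) (E_snd r z))"

text \<open>
  \<open>f\<close> is Frechet differentiable on the open set \<open>W \<subseteq> E_r\<close>, its tangent map is Frechet
  differentiable on \<open>W \<times> E_r\<close>, and so on, \<open>k\<close> times.  For a fixed \<open>k \<ge> 1\<close> this lies between
  \<open>C^k\<close> and \<open>C^(k-1)\<close>; required for all \<open>k\<close> it is the usual \<open>C\<close>-infinity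
  (differentiability of \<open>(x, v) \<mapsto> Df(x) v\<close> at \<open>(x, 0)\<close> already makes \<open>Df\<close> continuous for
  the operator norm).
\<close>

fun E_times_diff ::
  "nat \<Rightarrow> nat \<Rightarrow> nat \<Rightarrow> (nat \<Rightarrow>\<^sub>0 'e::real_normed_vector) set
     \<Rightarrow> ((nat \<Rightarrow>\<^sub>0 'e) \<Rightarrow> (nat \<Rightarrow>\<^sub>0 'f::real_normed_vector)) \<Rightarrow> bool" where
  "E_times_diff 0 r s W f \<longleftrightarrow> continuous_on W f"
| "E_times_diff (Suc k) r s W f \<longleftrightarrow>
     (\<forall>x\<in>W. f differentiable (at x within E_space r)) \<and>
     E_times_diff k (Suc r) (Suc s) {z \<in> E_space (Suc r). E_fst r z \<in> W} (E_tangent r s f)"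

definition E_smooth_on ::
  "nat \<Rightarrow> nat \<Rightarrow> (nat \<Rightarrow>\<^sub>0 'e::real_normed_vector) set
     \<Rightarrow> ((nat \<Rightarrow>\<^sub>0 'e) \<Rightarrow> (nat \<Rightarrow>\<^sub>0 'f::real_normed_vector)) \<Rightarrow> bool" where
  "E_smooth_on r s W f \<longleftrightarrow> (\<forall>k. E_times_diff k r s W f)"

text \<open>The same for maps between the spaces themselves, via \<open>E = E_0\<close>.\<close>

definition smooth_on :: "'e::real_normed_vector set \<Rightarrow> ('e \<Rightarrow> 'f::real_normed_vector) \<Rightarrow> bool" where
  "smooth_on U f \<longleftrightarrow>
     E_smooth_on 0 0 (Poly_Mapping.single 0 ` U)
       (\<lambda>x. Poly_Mapping.single 0 (f (Poly_Mapping.lookup x 0)))"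


section \<open>Smoothness between Frechet spaces\<close>

text \<open>
  A projective limit of normed spaces is a linear subspace \<open>F\<close> of a countable product
  \<open>nat \<Rightarrow> 'v\<close>, with pointwise operations and the topology induced by the product topology.
  On an open subset \<open>W\<close> of \<open>F\<close> smoothness is meant in the sense of Michal, Bastiani and
  Hamilton: all iterated directional derivatives \<open>d k x (h 0, ..., h (k-1))\<close> exist and are
  jointly continuous in \<open>x \<in> W\<close> and the directions.  The directions are passed as an
  infinite sequence, of which \<open>d k\<close> only uses the first \<open>k\<close> members.
\<close>

definition frechet_smooth_on ::
  "(nat \<Rightarrow> 'v::real_normed_vector) set \<Rightarrow> (nat \<Rightarrow> 'v) set
     \<Rightarrow> ((nat \<Rightarrow> 'v) \<Rightarrow> (nat \<Rightarrow> 'w::real_normed_vector)) \<Rightarrow> bool" where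
  "frechet_smooth_on F W f \<longleftrightarrow>
     (\<exists>d :: nat \<Rightarrow> (nat \<Rightarrow> 'v) \<Rightarrow> (nat \<Rightarrow> nat \<Rightarrow> 'v) \<Rightarrow> (nat \<Rightarrow> 'w).
        (\<forall>x\<in>W. \<forall>h. d 0 x h = f x) \<and>
        (\<forall>k. continuous_on (W \<times> {h. range h \<subseteq> F}) (\<lambda>(x, h). d k x h)) \<and>
        (\<forall>k. \<forall>x\<in>W. \<forall>h. range h \<subseteq> F \<longrightarrow>
           ((\<lambda>t. (\<lambda>i. (d k (\<lambda>j. x j + t *\<^sub>R h k j) h i - d k x h i) /\<^sub>R t))
              \<longlongrightarrow> d (Suc k) x h) (at (0::real))))"


section \<open>Manifolds given by an atlas\<close>

record ('p, 'i, 'v) mfd =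
  points :: "'p set"
  index  :: "'i set"
  cdom   :: "'i \<Rightarrow> 'p set"
  chart  :: "'i \<Rightarrow> 'p \<Rightarrow> 'v"
  model  :: "'v set"

definition chart_inv :: "('p, 'i, 'v) mfd \<Rightarrow> 'i \<Rightarrow> 'v \<Rightarrow> 'p" where
  "chart_inv N \<alpha> = inv_into (cdom N \<alpha>) (chart N \<alpha>)"

definition mfd_topology :: "('p, 'i, 'v::topological_space) mfd \<Rightarrow> 'p topology" where
  "mfd_topology N = topology (\<lambda>W. W \<subseteq> points N \<and>
     (\<forall>\<alpha>\<in>index N. openin (top_of_set (model N)) (chart N \<alpha> ` (W \<inter> cdom N \<alpha>))))"

text \<open>Here \<open>'e\<close> itself is the model space.\<close>

definition banach_manifold :: "('a, 'i, 'e::banach) mfd \<Rightarrow> bool" where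
  "banach_manifold M \<longleftrightarrow>
     model M = UNIV \<and>
     points M = (\<Union>\<alpha>\<in>index M. cdom M \<alpha>) \<and>
     (\<forall>\<alpha>\<in>index M. inj_on (chart M \<alpha>) (cdom M \<alpha>)) \<and>
     (\<forall>\<alpha>\<in>index M. \<forall>\<beta>\<in>index M. open (chart M \<alpha> ` (cdom M \<alpha> \<inter> cdom M \<beta>))) \<and>
     (\<forall>\<alpha>\<in>index M. \<forall>\<beta>\<in>index M.
        smooth_on (chart M \<alpha> ` (cdom M \<alpha> \<inter> cdom M \<beta>)) (chart M \<beta> \<circ> chart_inv M \<alpha>)) \<and>
     Hausdorff_space (mfd_topology M)"

definition smooth_function :: "('a, 'i, 'e::banach) mfd \<Rightarrow> ('a \<Rightarrow> real) \<Rightarrow> bool" where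
  "smooth_function M g \<longleftrightarrow>
     (\<forall>\<alpha>\<in>index M. smooth_on (chart M \<alpha> ` cdom M \<alpha>) (g \<circ> chart_inv M \<alpha>))"

text \<open>
  Every open cover has a subordinate smooth partition of unity; the functions are indexed by
  the members of the cover.
\<close>

definition partitionable :: "('a, 'i, 'e::banach) mfd \<Rightarrow> bool" where
  "partitionable M \<longleftrightarrow>
     (\<forall>\<U>. (\<forall>U\<in>\<U>. openin (mfd_topology M) U) \<and> \<Union>\<U> = points M \<longrightarrow>
        (\<exists>\<psi> :: 'a set \<Rightarrow> 'a \<Rightarrow> real.
           (\<forall>U\<in>\<U>. smooth_function M (\<psi> U) \<and> (\<forall>x\<in>points M. 0 \<le> \<psi> U x) \<and>
                  mfd_topology M closure_of {x \<in> points M. \<psi> U x \<noteq> 0} \<subseteq> U) \<and>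
           (\<forall>x\<in>points M. \<exists>W. openin (mfd_topology M) W \<and> x \<in> W \<and>
                  finite {U \<in> \<U>. \<exists>y\<in>W. \<psi> U y \<noteq> 0}) \<and>
           (\<forall>x\<in>points M. (\<Sum>U | U \<in> \<U> \<and> \<psi> U x \<noteq> 0. \<psi> U x) = 1)))"

text \<open>
  Smooth maps between manifolds: \<open>f\<close> has, near every point, a local representative that is
  smooth.  Smoothness on open subsets of the model spaces is the parameter \<open>sm\<close>.
\<close>

definition smooth_map_wrt ::
  "('v set \<Rightarrow> ('v \<Rightarrow> 'w) \<Rightarrow> bool) \<Rightarrow> ('p, 'i, 'v::topological_space) mfd \<Rightarrow> ('q, 'j, 'w) mfd
     \<Rightarrow> ('p \<Rightarrow> 'q) \<Rightarrow> bool" where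
  "smooth_map_wrt sm N P f \<longleftrightarrow>
     (\<forall>p\<in>points N. f p \<in> points P \<and>
        (\<exists>\<alpha>\<in>index N. \<exists>\<beta>\<in>index P. \<exists>W.
           p \<in> cdom N \<alpha> \<and> openin (top_of_set (model N)) W \<and>
           chart N \<alpha> p \<in> W \<and> W \<subseteq> chart N \<alpha> ` cdom N \<alpha> \<and>
           f ` chart_inv N \<alpha> ` W \<subseteq> cdom P \<beta> \<and>
           sm W (chart P \<beta> \<circ> f \<circ> chart_inv N \<alpha>)))"


section \<open>Tangent bundles\<close>

text \<open>
  A tangent vector \<open>Tan p C\<close> at \<open>p\<close> is an equivalence class \<open>C\<close> of pairs
  (chart at \<open>p\<close>, vector of the model space), two pairs being equivalent when the derivative
  of the chart change maps one vector to the other.  The type is recursive so that all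
  iterated tangent bundles live in it; \<open>Pt\<close> injects the points of \<open>M\<close>.
\<close>

datatype ('a, 'i, 'v) tpoint =
    Pt 'a
  | Tan (foot: "('a, 'i, 'v) tpoint") (tvec: "('i \<times> 'v) set")

type_synonym ('a, 'i, 'e) tmfd = "(('a, 'i, nat \<Rightarrow>\<^sub>0 'e) tpoint, 'i, nat \<Rightarrow>\<^sub>0 'e) mfd"

definition tangent_class ::
  "('p, 'i, 'v::real_normed_vector) mfd \<Rightarrow> 'p \<Rightarrow> 'i \<Rightarrow> 'v \<Rightarrow> ('i \<times> 'v) set" where
  "tangent_class N p \<alpha> v =
     {(\<beta>, w). \<beta> \<in> index N \<and> p \<in> cdom N \<beta> \<and>
        w = frechet_derivative (chart N \<beta> \<circ> chart_inv N \<alpha>) (at (chart N \<alpha> p) within model N) v}"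

text \<open>The tangent bundle of a manifold modeled on \<open>E_r\<close>, with the charts \<open>D\<phi>\<^sub>\<alpha>\<close>.\<close>

definition tangent_bundle ::
  "nat \<Rightarrow> ('a, 'i, 'e::real_normed_vector) tmfd \<Rightarrow> ('a, 'i, 'e) tmfd" where
  "tangent_bundle r N =
     \<lparr> points = {Tan p (tangent_class N p \<alpha> v) | p \<alpha> v.
                   p \<in> points N \<and> \<alpha> \<in> index N \<and> p \<in> cdom N \<alpha> \<and> v \<in> model N},
       index = index N,
       cdom = (\<lambda>\<alpha>. {Tan p (tangent_class N p \<alpha> v) | p v. p \<in> cdom N \<alpha> \<and> v \<in> model N}),
       chart = (\<lambda>\<alpha> \<xi>. E_pair r (chart N \<alpha> (foot \<xi>)) (THE v. (\<alpha>, v) \<in> tvec \<xi>)),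
       model = E_space (Suc r) \<rparr>"

definition T_zero :: "('a, 'i, 'e::real_normed_vector) mfd \<Rightarrow> ('a, 'i, 'e) tmfd" where
  "T_zero M =
     \<lparr> points = Pt ` points M,
       index = index M,
       cdom = (\<lambda>\<alpha>. Pt ` cdom M \<alpha>),
       chart = (\<lambda>\<alpha> \<xi>. Poly_Mapping.single 0 (chart M \<alpha> (THE p. \<xi> = Pt p))),
       model = E_space 0 \<rparr>"

fun TB :: "('a, 'i, 'e::real_normed_vector) mfd \<Rightarrow> nat \<Rightarrow> ('a, 'i, 'e) tmfd" where
  "TB M 0 = T_zero M"
| "TB M (Suc r) = tangent_bundle r (TB M r)"

text \<open>
  The projection \<open>\<pi>\<^sub>r : T^(r+1)M \<rightarrow> T^rM\<close> is \<open>foot\<close>, for every \<open>r\<close>.  The tangent map of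
  \<open>f : N \<rightarrow> P\<close> acts through local representatives.
\<close>

definition tangent_map ::
  "('p, 'i, 'v::real_normed_vector) mfd \<Rightarrow> ('q, 'j, 'w::real_normed_vector) mfd
     \<Rightarrow> ('p \<Rightarrow> 'q) \<Rightarrow> 'p \<Rightarrow> ('i \<times> 'v) set \<Rightarrow> ('j \<times> 'w) set" where
  "tangent_map N P f p C =
     {(\<beta>, w). \<beta> \<in> index P \<and> f p \<in> cdom P \<beta> \<and>
        (\<exists>(\<alpha>, v)\<in>C. w = frechet_derivative (chart P \<beta> \<circ> f \<circ> chart_inv N \<alpha>)
                              (at (chart N \<alpha> p) within model N) v)}"

definition tmap ::
  "('a, 'i, 'e::real_normed_vector) tmfd \<Rightarrow> ('a, 'i, 'e) tmfd
     \<Rightarrow> (('a, 'i, nat \<Rightarrow>\<^sub>0 'e) tpoint \<Rightarrow> ('a, 'i, nat \<Rightarrow>\<^sub>0 'e) tpoint)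
     \<Rightarrow> ('a, 'i, nat \<Rightarrow>\<^sub>0 'e) tpoint \<Rightarrow> ('a, 'i, nat \<Rightarrow>\<^sub>0 'e) tpoint" where
  "tmap N P f \<xi> = Tan (f (foot \<xi>)) (tangent_map N P f (foot \<xi>) (tvec \<xi>))"


section \<open>Canonical involution, complete lift, semisprays\<close>

text \<open>For \<open>r \<ge> 2\<close> the involution is \<open>(x, y, X, Y) \<mapsto> (x, X, y, Y)\<close> in every chart \<open>\<phi>\<^sub>\<alpha>\<^sub>r\<close>.\<close>

fun kappa ::
  "('a, 'i, 'e::real_normed_vector) mfd \<Rightarrow> nat
     \<Rightarrow> ('a, 'i, nat \<Rightarrow>\<^sub>0 'e) tpoint \<Rightarrow> ('a, 'i, nat \<Rightarrow>\<^sub>0 'e) tpoint" where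
  "kappa M (Suc (Suc r)) \<xi> =
     (THE \<eta>. \<eta> \<in> points (TB M (Suc (Suc r))) \<and>
        (\<forall>\<alpha>\<in>index M. \<xi> \<in> cdom (TB M (Suc (Suc r))) \<alpha> \<longrightarrow>
           \<eta> \<in> cdom (TB M (Suc (Suc r))) \<alpha> \<and>
           chart (TB M (Suc (Suc r))) \<alpha> \<eta> = E_flip r (chart (TB M (Suc (Suc r))) \<alpha> \<xi>)))"
| "kappa M r \<xi> = \<xi>"

definition complete_lift ::
  "('a, 'i, 'e::real_normed_vector) mfd \<Rightarrow> nat
     \<Rightarrow> (('a, 'i, nat \<Rightarrow>\<^sub>0 'e) tpoint \<Rightarrow> ('a, 'i, nat \<Rightarrow>\<^sub>0 'e) tpoint)
     \<Rightarrow> ('a, 'i, nat \<Rightarrow>\<^sub>0 'e) tpoint \<Rightarrow> ('a, 'i, nat \<Rightarrow>\<^sub>0 'e) tpoint" where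
  "complete_lift M r A =
     tmap (TB M (r + 1)) (TB M (r + 1)) (kappa M (r + 1)) \<circ> kappa M (r + 2) \<circ>
     tmap (TB M r) (TB M (r + 1)) A \<circ> kappa M (r + 1)"

text \<open>\<open>iterated_lift M S j\<close> is \<open>S^(c_j)\<close>, a vector field on \<open>T^(j+1)M\<close>.\<close>

fun iterated_lift ::
  "('a, 'i, 'e::real_normed_vector) mfd
     \<Rightarrow> (('a, 'i, nat \<Rightarrow>\<^sub>0 'e) tpoint \<Rightarrow> ('a, 'i, nat \<Rightarrow>\<^sub>0 'e) tpoint) \<Rightarrow> nat
     \<Rightarrow> ('a, 'i, nat \<Rightarrow>\<^sub>0 'e) tpoint \<Rightarrow> ('a, 'i, nat \<Rightarrow>\<^sub>0 'e) tpoint" where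
  "iterated_lift M S 0 = S"
| "iterated_lift M S (Suc j) = complete_lift M (j + 1) (iterated_lift M S j)"

definition vector_field ::
  "('a, 'i, 'e::real_normed_vector) mfd \<Rightarrow> nat
     \<Rightarrow> (('a, 'i, nat \<Rightarrow>\<^sub>0 'e) tpoint \<Rightarrow> ('a, 'i, nat \<Rightarrow>\<^sub>0 'e) tpoint) \<Rightarrow> bool" where
  "vector_field M r A \<longleftrightarrow>
     smooth_map_wrt (E_smooth_on r (Suc r)) (TB M r) (TB M (Suc r)) A \<and>
     (\<forall>\<xi>\<in>points (TB M r). foot (A \<xi>) = \<xi>)"

text \<open>A semispray on \<open>T^(r-1)M\<close>, for \<open>r \<ge> 1\<close>.\<close>

definition semispray ::
  "('a, 'i, 'e::real_normed_vector) mfd \<Rightarrow> nat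
     \<Rightarrow> (('a, 'i, nat \<Rightarrow>\<^sub>0 'e) tpoint \<Rightarrow> ('a, 'i, nat \<Rightarrow>\<^sub>0 'e) tpoint) \<Rightarrow> bool" where
  "semispray M r S \<longleftrightarrow>
     vector_field M r S \<and> (\<forall>\<xi>\<in>points (TB M r). kappa M (r + 1) (S \<xi>) = S \<xi>)"


section \<open>The projective limit and its tangent bundles\<close>

text \<open>
  \<open>conn M j i = D^j \<pi>\<^sub>i : T^j(T^(i+1)M) \<rightarrow> T^j(T^iM)\<close>, and \<open>E_conn j i\<close> is the corresponding
  linear map \<open>E_(i+1+j) \<rightarrow> E_(i+j)\<close> of model spaces: the first projection of \<open>E_i \<times> E_i\<close>
  for \<open>j = 0\<close>, and two copies of the previous map (the tangent map of a linear map) after that.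
\<close>

fun conn ::
  "('a, 'i, 'e::real_normed_vector) mfd \<Rightarrow> nat \<Rightarrow> nat
     \<Rightarrow> ('a, 'i, nat \<Rightarrow>\<^sub>0 'e) tpoint \<Rightarrow> ('a, 'i, nat \<Rightarrow>\<^sub>0 'e) tpoint" where
  "conn M 0 i = foot"
| "conn M (Suc j) i = tmap (TB M (i + 1 + j)) (TB M (i + j)) (conn M j i)"

fun E_conn :: "nat \<Rightarrow> nat \<Rightarrow> (nat \<Rightarrow>\<^sub>0 'e::real_normed_vector) \<Rightarrow> (nat \<Rightarrow>\<^sub>0 'e)" where
  "E_conn 0 i z = E_fst i z"
| "E_conn (Suc j) i z =
     E_pair (i + j) (E_conn j i (E_fst (i + 1 + j) z)) (E_conn j i (E_snd (i + 1 + j) z))"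

text \<open>
  \<open>T_infinity M j = lim {T^j(T^iM), D^j \<pi>\<^sub>i}\<close>; for \<open>j = 0, 1, 2\<close> this is the limit
  \<open>T^\<infinity>M\<close>, its tangent bundle, and its second tangent bundle.  The charts are the limits
  of the charts, with values in the limit of the model spaces.
\<close>

definition T_infinity ::
  "('a, 'i, 'e::real_normed_vector) mfd \<Rightarrow> nat
     \<Rightarrow> (nat \<Rightarrow> ('a, 'i, nat \<Rightarrow>\<^sub>0 'e) tpoint, 'i, nat \<Rightarrow> (nat \<Rightarrow>\<^sub>0 'e)) mfd" where
  "T_infinity M j =
     \<lparr> points = {\<xi>. \<forall>i. \<xi> i \<in> points (TB M (i + j)) \<and> conn M j i (\<xi> (Suc i)) = \<xi> i},
       index = index M,
       cdom = (\<lambda>\<alpha>. {\<xi>. \<forall>i. \<xi> i \<in> cdom (TB M (i + j)) \<alpha> \<and> conn M j i (\<xi> (Suc i)) = \<xi> i}),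
       chart = (\<lambda>\<alpha> \<xi> i. chart (TB M (i + j)) \<alpha> (\<xi> i)),
       model = {x. \<forall>i. x i \<in> E_space (i + j) \<and> E_conn j i (x (Suc i)) = x i} \<rparr>"

text \<open>
  A semispray on \<open>T^\<infinity>M\<close>: a smooth section \<open>S\<close> of the tangent bundle of \<open>T T^\<infinity>M\<close> (whose
  projection is the limit of the projections \<open>foot\<close>) with \<open>D\<pi> \<circ> S = id\<close>, where
  \<open>\<pi> = lim \<pi>\<^sub>i : T T^\<infinity>M \<rightarrow> T^\<infinity>M\<close> with \<open>\<pi>\<^sub>i = foot : T(T^iM) \<rightarrow> T^iM\<close>, and \<open>D\<pi> = lim D\<pi>\<^sub>i\<close>
  under the identification of the tangent bundles of \<open>T^\<infinity>M\<close> with projective limits.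
\<close>

definition vector_field_TT_infinity ::
  "('a, 'i, 'e::real_normed_vector) mfd
     \<Rightarrow> ((nat \<Rightarrow> ('a, 'i, nat \<Rightarrow>\<^sub>0 'e) tpoint) \<Rightarrow> (nat \<Rightarrow> ('a, 'i, nat \<Rightarrow>\<^sub>0 'e) tpoint)) \<Rightarrow> bool" where
  "vector_field_TT_infinity M S \<longleftrightarrow>
     smooth_map_wrt (frechet_smooth_on (model (T_infinity M 1))) (T_infinity M 1) (T_infinity M 2) S \<and>
     (\<forall>\<xi>\<in>points (T_infinity M 1). (\<lambda>i. foot (S \<xi> i)) = \<xi>)"

definition semispray_T_infinity ::
  "('a, 'i, 'e::real_normed_vector) mfd
     \<Rightarrow> ((nat \<Rightarrow> ('a, 'i, nat \<Rightarrow>\<^sub>0 'e) tpoint) \<Rightarrow> (nat \<Rightarrow> ('a, 'i, nat \<Rightarrow>\<^sub>0 'e) tpoint)) \<Rightarrow> bool" where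
  "semispray_T_infinity M S \<longleftrightarrow>
     vector_field_TT_infinity M S \<and>
     (\<forall>\<xi>\<in>points (T_infinity M 1). (\<lambda>i. tmap (TB M (i + 1)) (TB M i) foot (S \<xi> i)) = \<xi>)"

definition lift_infinity ::
  "('a, 'i, 'e::real_normed_vector) mfd
     \<Rightarrow> (('a, 'i, nat \<Rightarrow>\<^sub>0 'e) tpoint \<Rightarrow> ('a, 'i, nat \<Rightarrow>\<^sub>0 'e) tpoint)
     \<Rightarrow> (nat \<Rightarrow> ('a, 'i, nat \<Rightarrow>\<^sub>0 'e) tpoint) \<Rightarrow> (nat \<Rightarrow> ('a, 'i, nat \<Rightarrow>\<^sub>0 'e) tpoint)" where
  "lift_infinity M S = (\<lambda>\<xi> i. iterated_lift M S i (\<xi> i))"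

end

theory Submission
  imports Defs
begin

text \<open>One obstacle is that all model spaces share one type, in which \<open>E_space r\<close>
  is in general a proper subspace: a derivative within it is determined only on directions in
  \<open>E_space r\<close>, and \<open>frechet_derivative\<close> is an arbitrary choice elsewhere.
  The nesting of E_r in E_(r+1) as the vectors (x, 0) pays this back: adding a vector of E_r to a
  point of an iterated tangent space moves only the base component, and so directional derivatives
  of every order can be read off iterated tangent maps.

  The other obstacle is that a projective limit of open sets need not be open in the product
  topology. Here it is, because each induced chart domain is the full preimage of a chart domain of
  M: its image is cut out by a condition on coordinate 0, the component over M, and the connecting
  maps keep that coordinate.\<close>

text \<open>
  Every map in the statement covers the identity of \<open>M\<close>, so it can be computed in the charts
  \<open>\<phi>\<^sub>\<alpha>\<^sub>r\<close> induced by one chart \<open>\<phi>\<^sub>\<alpha>\<close>; that the involutions are well defined is the symmetry of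
  the second derivative of the transition maps.  Write \<open>\<kappa>\<close> for the flip, \<open>p\<close> for the bundle
  projection and \<open>T\<close> for the tangent functor, so that \<open>A\<^sup>c = T\<kappa> \<circ> \<kappa> \<circ> TA \<circ> \<kappa>\<close>.  A semispray \<open>A\<close> is
  a section of both \<open>p\<close> and \<open>Tp\<close>.  As \<open>\<kappa>\<close> is an involution with \<open>p \<circ> \<kappa> = Tp\<close> which commutes with \<open>TTL\<close>
  for every linear \<open>L\<close>, functoriality of \<open>T\<close> gives \<open>p \<circ> A\<^sup>c = id\<close>, \<open>Tp \<circ> A\<^sup>c = id\<close> and
  \<open>TTp \<circ> A\<^sup>c = A \<circ> Tp\<close>.  The last identity makes the lifts a map of projective systems.  Its limit
  is smooth because the iterated directional derivatives of the limit are those of its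
  components.
\<close>

section \<open>Linear algebra of the model spaces\<close>

lemma norm_lookup_le: "norm (Poly_Mapping.lookup x n) \<le> norm x"
  for x :: "'a \<Rightarrow>\<^sub>0 'e::real_normed_vector"
proof (cases "n \<in> Poly_Mapping.keys x")
  case True
  have "norm x = (\<Sum>m\<in>Poly_Mapping.keys x. norm (Poly_Mapping.lookup x m))"
    by (simp add: norm_poly_mapping_def dist_poly_mapping_def)
  with True show ?thesis
    using member_le_sum[of n "Poly_Mapping.keys x" "\<lambda>m. norm (Poly_Mapping.lookup x m)"] by simp
next
  case False
  then show ?thesis
    by (simp add: in_keys_iff)
qed

lemma lookup_scaleR: "Poly_Mapping.lookup (c *\<^sub>R x) n = c *\<^sub>R Poly_Mapping.lookup x n"
  for x :: "'a \<Rightarrow>\<^sub>0 'e::real_normed_vector"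
proof -
  have "finite {i. c *\<^sub>R Poly_Mapping.lookup x i \<noteq> 0}"
    by (rule finite_subset[OF _ finite_keys[of x]]) (auto simp: in_keys_iff)
  then show ?thesis
    by (simp add: scaleR_poly_mapping_def)
qed

lemma bounded_linear_lookup: "bounded_linear (\<lambda>x :: 'a \<Rightarrow>\<^sub>0 'e::real_normed_vector. Poly_Mapping.lookup x n)"
  by (rule bounded_linear_intro[where K = 1])
     (auto simp: lookup_add lookup_scaleR norm_lookup_le)

lemma norm_single: "norm (Poly_Mapping.single n v) = norm v"
  for v :: "'e::real_normed_vector"
  by (simp add: norm_poly_mapping_def dist_poly_mapping_def)

lemma bounded_linear_single: "bounded_linear (\<lambda>v :: 'e::real_normed_vector. Poly_Mapping.single n v)"
  by (rule bounded_linear_intro[where K = 1])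
     (auto simp: norm_single single_add lookup_scaleR lookup_single when_def intro: poly_mapping_eqI)

lemma subspace_E_space: "subspace (E_space r)"
  by (auto simp: subspace_def E_space_def lookup_add lookup_scaleR)

lemma E_space_mono:
  assumes "r \<le> s"
  shows "(E_space r :: (nat \<Rightarrow>\<^sub>0 'e::real_normed_vector) set) \<subseteq> E_space s"
proof
  fix x :: "nat \<Rightarrow>\<^sub>0 'e"
  assume x: "x \<in> E_space r"
  have *: "(2::nat) ^ r \<le> 2 ^ s"
    using assms by (simp add: power_increasing)
  have "Poly_Mapping.lookup x n = 0" if "n \<ge> 2 ^ s" for n
    using x order_trans[OF * that] by (simp add: E_space_def)
  then show "x \<in> E_space s"
    by (simp add: E_space_def)
qed

lemma lookup_E_fst: "Poly_Mapping.lookup (E_fst r z) n = (if n < 2 ^ r then Poly_Mapping.lookup z n else 0)"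
  by (simp add: E_fst_def lookup_sum lookup_single when_def)

lemma lookup_E_snd: "Poly_Mapping.lookup (E_snd r z) n = (if n < 2 ^ r then Poly_Mapping.lookup z (2 ^ r + n) else 0)"
  by (simp add: E_snd_def lookup_sum lookup_single when_def)

lemma lookup_E_pair: "Poly_Mapping.lookup (E_pair r x y) n =
  (if n < 2 ^ r then Poly_Mapping.lookup x n
   else if n < 2 ^ Suc r then Poly_Mapping.lookup y (n - 2 ^ r) else 0)"
proof -
  have "Poly_Mapping.lookup (E_pair r x y) n =
     (\<Sum>k<2 ^ r. if k = n then Poly_Mapping.lookup x n else 0)
     + (\<Sum>k<2 ^ r. if 2 ^ r + k = n then Poly_Mapping.lookup y k else 0)"
    by (simp add: E_pair_def lookup_sum lookup_add lookup_single when_def sum.distrib cong: if_cong)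
  moreover have "(\<Sum>k<2 ^ r. if 2 ^ r + k = n then Poly_Mapping.lookup y k else 0)
    = (\<Sum>k<2 ^ r. if k = n - 2 ^ r then if 2 ^ r \<le> n then Poly_Mapping.lookup y (n - 2 ^ r) else 0 else 0)"
    by (intro sum.cong) auto
  ultimately show ?thesis
    by (auto simp: sum.delta')
qed

lemma E_fst_in [simp]: "E_fst r z \<in> E_space r"
  and E_snd_in [simp]: "E_snd r z \<in> E_space r"
  and E_pair_in [simp]: "E_pair r x y \<in> E_space (Suc r)"
  by (auto simp: E_space_def lookup_E_fst lookup_E_snd lookup_E_pair)

lemma E_fst_pair [simp]: "x \<in> E_space r \<Longrightarrow> E_fst r (E_pair r x y) = x"
  and E_snd_pair [simp]: "y \<in> E_space r \<Longrightarrow> E_snd r (E_pair r x y) = y"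
  by (rule poly_mapping_eqI; auto simp: lookup_E_fst lookup_E_snd lookup_E_pair E_space_def)+

lemma E_pair_fst_snd [simp]: "z \<in> E_space (Suc r) \<Longrightarrow> E_pair r (E_fst r z) (E_snd r z) = z"
  by (rule poly_mapping_eqI) (auto simp: lookup_E_fst lookup_E_snd lookup_E_pair E_space_def)

lemma E_pair_eq_iff:
  assumes "x \<in> E_space r" "y \<in> E_space r" "x' \<in> E_space r" "y' \<in> E_space r"
  shows "E_pair r x y = E_pair r x' y' \<longleftrightarrow> x = x' \<and> y = y'"
  using assms by (metis E_fst_pair E_snd_pair)

lemma E_space_Suc_cases:
  assumes "z \<in> E_space (Suc r)"
  obtains x y where "z = E_pair r x y" "x \<in> E_space r" "y \<in> E_space r"
  using assms by (metis E_fst_in E_snd_in E_pair_fst_snd)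

lemma E_space_Suc_Suc_cases:
  assumes "z \<in> E_space (Suc (Suc r))"
  obtains x y X Y where "z = E_pair (Suc r) (E_pair r x y) (E_pair r X Y)"
    "x \<in> E_space r" "y \<in> E_space r" "X \<in> E_space r" "Y \<in> E_space r"
  using assms by (metis E_space_Suc_cases)

lemma bounded_linear_E_fst: "bounded_linear (E_fst r)"
  unfolding E_fst_def
  by (intro bounded_linear_sum bounded_linear_compose[OF bounded_linear_single] bounded_linear_lookup)

lemma bounded_linear_E_snd: "bounded_linear (E_snd r)"
  unfolding E_snd_def
  by (intro bounded_linear_sum bounded_linear_compose[OF bounded_linear_single] bounded_linear_lookup)

lemma bounded_linear_E_pair:
  assumes "bounded_linear f" "bounded_linear g"
  shows "bounded_linear (\<lambda>x. E_pair r (f x) (g x))"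
  unfolding E_pair_def
  by (intro bounded_linear_sum bounded_linear_add bounded_linear_compose[OF bounded_linear_single]
      bounded_linear_compose[OF bounded_linear_lookup] assms)

lemma continuous_on_E_pair [continuous_intros]:
  assumes "continuous_on A f" "continuous_on A g"
  shows "continuous_on A (\<lambda>x. E_pair r (f x) (g x))"
  unfolding E_pair_def
  by (intro continuous_intros bounded_linear.continuous_on[OF bounded_linear_single]
      bounded_linear.continuous_on[OF bounded_linear_lookup] assms)

section \<open>The flip and tangent maps of linear maps\<close>

lemma E_flip_pair:
  assumes "x \<in> E_space r" "y \<in> E_space r" "X \<in> E_space r" "Y \<in> E_space r"
  shows "E_flip r (E_pair (Suc r) (E_pair r x y) (E_pair r X Y))
       = E_pair (Suc r) (E_pair r x X) (E_pair r y Y)"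
  using assms by (simp add: E_flip_def)

lemma bounded_linear_E_flip: "bounded_linear (E_flip r)"
  unfolding E_flip_def
  by (intro bounded_linear_E_pair bounded_linear_compose[OF bounded_linear_E_fst]
      bounded_linear_compose[OF bounded_linear_E_snd] bounded_linear_E_fst bounded_linear_E_snd)

lemma E_flip_in [simp]: "E_flip r z \<in> E_space (Suc (Suc r))"
  by (simp add: E_flip_def)

lemma E_flip_flip: "z \<in> E_space (Suc (Suc r)) \<Longrightarrow> E_flip r (E_flip r z) = z"
  by (erule E_space_Suc_Suc_cases) (simp add: E_flip_pair)

text \<open>The tangent map of a linear \<open>L\<close> with no derivative in it;
  \<open>E_tangent_linear\<close> identifies the two. Identities among flips, projections and their
  tangent maps then reduce to comparing components.\<close>

definition lin_tangent ::
  "nat \<Rightarrow> nat \<Rightarrow> ((nat \<Rightarrow>\<^sub>0 'e::real_normed_vector) \<Rightarrow> (nat \<Rightarrow>\<^sub>0 'f::real_normed_vector))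
     \<Rightarrow> (nat \<Rightarrow>\<^sub>0 'e) \<Rightarrow> (nat \<Rightarrow>\<^sub>0 'f)" where
  "lin_tangent r s L z = E_pair s (L (E_fst r z)) (L (E_snd r z))"

lemma lin_tangent_in [simp]: "lin_tangent r s L z \<in> E_space (Suc s)"
  by (simp add: lin_tangent_def)

lemma bounded_linear_lin_tangent: "bounded_linear L \<Longrightarrow> bounded_linear (lin_tangent r s L)"
  unfolding lin_tangent_def
  by (rule bounded_linear_E_pair[OF bounded_linear_compose[OF _ bounded_linear_E_fst]
        bounded_linear_compose[OF _ bounded_linear_E_snd]])

lemma lin_tangent_pair:
  assumes "x \<in> E_space r" "y \<in> E_space r"
  shows "lin_tangent r s L (E_pair r x y) = E_pair s (L x) (L y)"
  using assms by (simp add: lin_tangent_def)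

lemma lin_tangent_compose:
  assumes "\<And>x. x \<in> E_space r \<Longrightarrow> f x \<in> E_space s"
  shows "lin_tangent s t g (lin_tangent r s f z) = lin_tangent r t (g \<circ> f) z"
  using assms by (simp add: lin_tangent_def)

lemma lin_tangent_cong:
  assumes "\<And>x. x \<in> E_space r \<Longrightarrow> f x = g x"
  shows "lin_tangent r s f z = lin_tangent r s g z"
  using assms by (simp add: lin_tangent_def)

lemma lin_tangent_id: "z \<in> E_space (Suc r) \<Longrightarrow> lin_tangent r r (\<lambda>x. x) z = z"
  by (simp add: lin_tangent_def)

lemma E_fst_lin_tangent:
  assumes "\<And>x. x \<in> E_space r \<Longrightarrow> f x \<in> E_space s"
  shows "E_fst s (lin_tangent r s f z) = f (E_fst r z)"
  using assms by (simp add: lin_tangent_def)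

text \<open>On (x, y, X, Y) both sides are (x, X): this is p \<circ> \<kappa> = Tp in coordinates.
  The next lemma is its mirror image Tp \<circ> \<kappa> = p.\<close>

lemma E_fst_E_flip:
  assumes "z \<in> E_space (Suc (Suc r))"
  shows "E_fst (Suc r) (E_flip r z) = lin_tangent (Suc r) r (E_fst r) z"
  using assms by (auto elim!: E_space_Suc_Suc_cases simp: E_flip_pair lin_tangent_pair)

lemma lin_tangent_E_fst_E_flip:
  assumes "z \<in> E_space (Suc (Suc r))"
  shows "lin_tangent (Suc r) r (E_fst r) (E_flip r z) = E_fst (Suc r) z"
  using assms by (auto elim!: E_space_Suc_Suc_cases simp: E_flip_pair lin_tangent_pair)

text \<open>TTL acts as L on each of the four components, so it does not matter whether the two
  middle ones are exchanged before or after.\<close>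

lemma lin_tangent_tangent_E_flip:
  assumes "z \<in> E_space (Suc (Suc r))" and L: "\<And>x. x \<in> E_space r \<Longrightarrow> L x \<in> E_space s"
  shows "lin_tangent (Suc r) (Suc s) (lin_tangent r s L) (E_flip r z)
       = E_flip s (lin_tangent (Suc r) (Suc s) (lin_tangent r s L) z)"
  using assms(1) by (auto elim!: E_space_Suc_Suc_cases simp: E_flip_pair lin_tangent_pair L)

lemma E_conn_Suc: "E_conn (Suc j) i = lin_tangent (i + 1 + j) (i + j) (E_conn j i)"
  by (rule ext) (simp add: lin_tangent_def)

lemma E_conn_0: "E_conn 0 i = E_fst i"
  by (rule ext) simp

lemma bounded_linear_E_conn: "bounded_linear (E_conn j i)"
  by (induction j) (auto simp: E_conn_Suc E_conn_0 bounded_linear_E_fst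
      intro: bounded_linear_lin_tangent simp del: E_conn.simps)

section \<open>Derivatives within the model spaces\<close>

abbreviation deriv_in :: "nat \<Rightarrow> ((nat \<Rightarrow>\<^sub>0 'e::real_normed_vector) \<Rightarrow> 'f::real_normed_vector)
    \<Rightarrow> (nat \<Rightarrow>\<^sub>0 'e) \<Rightarrow> (nat \<Rightarrow>\<^sub>0 'e) \<Rightarrow> 'f" where
  "deriv_in r f x \<equiv> frechet_derivative f (at x within E_space r)"

abbreviation open_in :: "nat \<Rightarrow> (nat \<Rightarrow>\<^sub>0 'e::real_normed_vector) set \<Rightarrow> bool" where
  "open_in r W \<equiv> openin (top_of_set (E_space r)) W"

lemma at_within_open_in:
  assumes "open_in r W" "x \<in> W"
  shows "at x within W = at x within E_space r"
proof -
  obtain T where "open T" "W = E_space r \<inter> T"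
    using assms(1) by (auto simp: openin_open)
  then show ?thesis
    using assms(2) by (intro at_within_nhd[of x T]) auto
qed

lemma has_derivative_along_line:
  assumes f: "(f has_derivative f') (at x within E_space r)" and "x \<in> E_space r" "v \<in> E_space r"
  shows "((\<lambda>t::real. f (x + t *\<^sub>R v)) has_derivative (\<lambda>t. t *\<^sub>R f' v)) (at 0)"
proof -
  have "((\<lambda>t::real. x + t *\<^sub>R v) has_derivative (\<lambda>t. t *\<^sub>R v)) (at 0)"
    by (auto intro!: derivative_eq_intros)
  moreover have "(\<lambda>t::real. x + t *\<^sub>R v) ` UNIV \<subseteq> E_space r"
    using assms subspace_E_space by (auto intro: subspace_add subspace_scale)
  then have "(f has_derivative f') (at (x + 0 *\<^sub>R v) within (\<lambda>t::real. x + t *\<^sub>R v) ` UNIV)"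
    using f by (auto intro: has_derivative_subset)
  ultimately have "((\<lambda>t::real. f (x + t *\<^sub>R v)) has_derivative (\<lambda>t. f' (t *\<^sub>R v))) (at 0)"
    by (rule has_derivative_in_compose)
  moreover have "linear f'"
    using f has_derivative_linear by blast
  ultimately show ?thesis
    by (simp add: linear_scale)
qed

text \<open>Uniqueness of derivatives within a subspace, which holds only for directions in it.
  Restricting to the line through \<open>x\<close> in direction \<open>v\<close> reduces it to
  uniqueness over the reals.\<close>

lemma deriv_in_eq:
  assumes "(f has_derivative f') (at x within E_space r)" "x \<in> E_space r" "v \<in> E_space r"
  shows "deriv_in r f x v = f' v"
proof -
  have "(f has_derivative deriv_in r f x) (at x within E_space r)"
    using assms(1) differentiable_def frechet_derivative_works by blast
  then have "(\<lambda>t::real. t *\<^sub>R deriv_in r f x v) = (\<lambda>t. t *\<^sub>R f' v)"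
    using assms by (intro has_derivative_unique[OF has_derivative_along_line has_derivative_along_line]) auto
  then show ?thesis
    by (metis scaleR_one)
qed

lemma has_derivative_cong_open_in:
  assumes "open_in r W" "x \<in> W" "\<And>y. y \<in> W \<Longrightarrow> f y = g y"
    and f: "(f has_derivative f') (at x within E_space r)"
  shows "(g has_derivative f') (at x within E_space r)"
proof -
  have "(f has_derivative f') (at x within W)"
    using f at_within_open_in[OF assms(1,2)] by simp
  then have "(g has_derivative f') (at x within W)"
    using assms by (intro has_derivative_transform[of x W g f]) auto
  then show ?thesis
    using at_within_open_in[OF assms(1,2)] by simp
qed

lemma differentiable_cong_open_in:
  assumes "open_in r W" "x \<in> W" "\<And>y. y \<in> W \<Longrightarrow> f y = g y"
    and "f differentiable (at x within E_space r)"
  shows "g differentiable (at x within E_space r)"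
  using assms has_derivative_cong_open_in unfolding differentiable_def by blast

lemma deriv_in_cong:
  assumes "open_in r W" "x \<in> W" "\<And>y. y \<in> W \<Longrightarrow> f y = g y"
  shows "deriv_in r f x = deriv_in r g x"
proof -
  \<comment> \<open>Both choices are made from the same set of derivatives, so they agree as
    functions, also off \<open>E_space r\<close>.\<close>
  have "(f has_derivative f') (at x within E_space r) \<longleftrightarrow> (g has_derivative f') (at x within E_space r)" for f'
    using has_derivative_cong_open_in[OF assms(1,2)] assms(3) by metis
  then show ?thesis
    by (simp add: frechet_derivative_def)
qed

lemma has_derivative_compose_in:
  assumes W: "open_in r W" "x \<in> W" and fW: "f ` W \<subseteq> E_space s"
    and f: "(f has_derivative f') (at x within E_space r)"
    and g: "(g has_derivative g') (at (f x) within E_space s)"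
  shows "((\<lambda>x. g (f x)) has_derivative (\<lambda>v. g' (f' v))) (at x within E_space r)"
proof -
  have "(f has_derivative f') (at x within W)"
    using f at_within_open_in[OF W] by simp
  then have "((\<lambda>x. g (f x)) has_derivative (\<lambda>v. g' (f' v))) (at x within W)"
    by (rule has_derivative_in_compose[OF _ has_derivative_subset[OF g fW]])
  then show ?thesis
    using at_within_open_in[OF W] by simp
qed

text \<open>Each coordinate of \<open>f\<close> beyond 2^s vanishes on \<open>W\<close>, hence so
  does its derivative in directions of \<open>E_space r\<close>.\<close>

lemma has_derivative_in_space:
  assumes W: "open_in r W" "x \<in> W" and fW: "f ` W \<subseteq> E_space s"
    and f: "(f has_derivative f') (at x within E_space r)" and v: "v \<in> E_space r"
  shows "f' v \<in> E_space s"
proof -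
  have xr: "x \<in> E_space r"
    using W openin_imp_subset by blast
  have "Poly_Mapping.lookup (f' v) n = 0" if n: "n \<ge> 2 ^ s" for n
  proof -
    have "((\<lambda>x. Poly_Mapping.lookup (f x) n) has_derivative (\<lambda>v. Poly_Mapping.lookup (f' v) n)) (at x within E_space r)"
      by (rule bounded_linear.has_derivative[OF bounded_linear_lookup f])
    moreover have "((\<lambda>x. Poly_Mapping.lookup (f x) n) has_derivative (\<lambda>v. 0)) (at x within E_space r)"
      by (rule has_derivative_cong_open_in[OF W, of "\<lambda>_. 0"])
         (use fW n in \<open>auto simp: E_space_def\<close>)
    ultimately show ?thesis
      using deriv_in_eq xr v by metis
  qed
  then show ?thesis
    by (simp add: E_space_def)
qed

lemma deriv_in_space:
  assumes "open_in r W" "x \<in> W" "f ` W \<subseteq> E_space s"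
    and "f differentiable (at x within E_space r)" "v \<in> E_space r"
  shows "deriv_in r f x v \<in> E_space s"
  using has_derivative_in_space[OF assms(1-3) _ assms(5)] assms(4)
  by (simp add: frechet_derivative_works)

section \<open>Tangent maps\<close>

definition tangent_set :: "nat \<Rightarrow> (nat \<Rightarrow>\<^sub>0 'e::real_normed_vector) set \<Rightarrow> (nat \<Rightarrow>\<^sub>0 'e) set" where
  "tangent_set r W = {z \<in> E_space (Suc r). E_fst r z \<in> W}"

lemma open_in_vimage:
  assumes "open_in r W" "continuous_on A f" "f ` A \<subseteq> E_space r"
  shows "openin (top_of_set A) {z \<in> A. f z \<in> W}"
  using continuous_openin_preimage[OF assms(2) _ assms(1)] assms(3)
  by (auto simp: vimage_def Int_def Pi_def image_subset_iff conj_commute cong: conj_cong)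

lemma open_in_tangent_set: "open_in r W \<Longrightarrow> open_in (Suc r) (tangent_set r W)"
  unfolding tangent_set_def
  by (rule open_in_vimage[where r = r]) (auto intro: bounded_linear.continuous_on[OF bounded_linear_E_fst] continuous_on_id)

lemma E_tangent_pair:
  assumes "x \<in> E_space r" "v \<in> E_space r"
  shows "E_tangent r s f (E_pair r x v) = E_pair s (f x) (deriv_in r f x v)"
  using assms by (simp add: E_tangent_def)

lemma E_tangent_in [simp]: "E_tangent r s f z \<in> E_space (Suc s)"
  by (simp add: E_tangent_def)

lemma E_fst_E_tangent:
  assumes "f (E_fst r z) \<in> E_space s"
  shows "E_fst s (E_tangent r s f z) = f (E_fst r z)"
  using assms by (simp add: E_tangent_def)

lemma E_tangent_maps:
  assumes "f ` W \<subseteq> V" "V \<subseteq> E_space s"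
  shows "E_tangent r s f ` tangent_set r W \<subseteq> tangent_set s V"
  using assms by (auto simp: tangent_set_def E_fst_E_tangent image_subset_iff subset_iff)

lemma E_tangent_cong:
  assumes "open_in r W" "\<And>x. x \<in> W \<Longrightarrow> f x = g x" "z \<in> tangent_set r W"
  shows "E_tangent r s f z = E_tangent r s g z"
  using assms deriv_in_cong[OF assms(1), of "E_fst r z" f g]
  by (simp add: E_tangent_def tangent_set_def)

lemma E_tangent_compose:
  assumes W: "open_in r W" and fW: "f ` W \<subseteq> E_space s"
    and f: "\<And>x. x \<in> W \<Longrightarrow> f differentiable (at x within E_space r)"
    and g: "\<And>x. x \<in> W \<Longrightarrow> g differentiable (at (f x) within E_space s)"
    and z: "z \<in> tangent_set r W"
  shows "E_tangent r t (g \<circ> f) z = E_tangent s t g (E_tangent r s f z)"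
proof -
  define x where "x = E_fst r z"
  have x: "x \<in> W" and xr: "x \<in> E_space r"
    using z by (auto simp: tangent_set_def x_def)
  have "((\<lambda>x. g (f x)) has_derivative (\<lambda>v. deriv_in s g (f x) (deriv_in r f x v))) (at x within E_space r)"
    by (rule has_derivative_compose_in[OF W x fW f[OF x, unfolded frechet_derivative_works]
          g[OF x, unfolded frechet_derivative_works]])
  then have "deriv_in r (g \<circ> f) x (E_snd r z) = deriv_in s g (f x) (deriv_in r f x (E_snd r z))"
    using xr by (simp add: deriv_in_eq comp_def)
  moreover have "deriv_in r f x (E_snd r z) \<in> E_space s"
    by (rule deriv_in_space[OF W x fW f[OF x]]) simp
  moreover have "f x \<in> E_space s"
    using x fW by auto
  ultimately show ?thesis
    by (simp add: E_tangent_def x_def)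
qed

lemma bounded_linear_differentiable:
  "bounded_linear L \<Longrightarrow> L differentiable (at x within A)"
  using bounded_linear_imp_has_derivative differentiable_def by blast

lemma E_tangent_linear:
  assumes "bounded_linear L"
  shows "E_tangent r s L z = lin_tangent r s L z"
  using deriv_in_eq[OF bounded_linear_imp_has_derivative[OF assms], of "E_fst r z" r "E_snd r z"]
  by (simp add: E_tangent_def lin_tangent_def)

lemma E_tangent_linear_compose:
  assumes "open_in r W" "f ` W \<subseteq> E_space s" "bounded_linear L"
    and "\<And>x. x \<in> W \<Longrightarrow> f differentiable (at x within E_space r)"
    and "z \<in> tangent_set r W"
  shows "E_tangent r t (\<lambda>x. L (f x)) z = lin_tangent s t L (E_tangent r s f z)"
  using E_tangent_compose[of r W f s L z t] assms
  by (simp add: bounded_linear_differentiable E_tangent_linear comp_def)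

lemma E_tangent_id:
  assumes "open_in r W" "\<And>x. x \<in> W \<Longrightarrow> f x = x" "z \<in> tangent_set r W"
  shows "E_tangent r r f z = z"
  using E_tangent_cong[OF assms, where s = r] E_tangent_linear[OF bounded_linear_ident, of r r z] assms(3)
  by (simp add: lin_tangent_id tangent_set_def)

text \<open>Functoriality applied to L \<circ> f = id. For a semispray it is used once with L = p
  and once with L = Tp.\<close>

lemma E_tangent_linear_section:
  assumes W: "open_in r W" and f: "f ` W \<subseteq> E_space s" and L: "bounded_linear L"
    and d: "\<And>x. x \<in> W \<Longrightarrow> f differentiable (at x within E_space r)"
    and "\<And>x. x \<in> W \<Longrightarrow> L (f x) = x" and z: "z \<in> tangent_set r W"
  shows "lin_tangent s r L (E_tangent r s f z) = z"
  using E_tangent_linear_compose[OF W f L d z, of r] E_tangent_id[OF W _ z, of "\<lambda>x. L (f x)"] assms(5)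
  by simp

section \<open>Calculus of smooth maps between the model spaces\<close>

lemma E_times_diff_Suc: "E_times_diff (Suc k) r s W f \<longleftrightarrow>
     (\<forall>x\<in>W. f differentiable (at x within E_space r)) \<and>
     E_times_diff k (Suc r) (Suc s) (tangent_set r W) (E_tangent r s f)"
  by (simp add: tangent_set_def)

declare E_times_diff.simps(2) [simp del]

lemma E_times_diff_cong:
  assumes "open_in r W" "\<And>x. x \<in> W \<Longrightarrow> f x = g x" "E_times_diff k r s W f"
  shows "E_times_diff k r s W g"
  using assms
proof (induction k arbitrary: r s W f g)
  case 0
  then show ?case
    by (simp cong: continuous_on_cong)
next
  case (Suc k)
  have "E_times_diff k (Suc r) (Suc s) (tangent_set r W) (E_tangent r s g)"
    using Suc.IH[OF open_in_tangent_set[OF Suc.prems(1)] E_tangent_cong[OF Suc.prems(1,2)]] Suc.prems(3)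
    by (auto simp: E_times_diff_Suc)
  then show ?case
    using Suc.prems differentiable_cong_open_in[OF Suc.prems(1) _ Suc.prems(2)]
    by (auto simp: E_times_diff_Suc)
qed

lemma tangent_set_mono: "W' \<subseteq> W \<Longrightarrow> tangent_set r W' \<subseteq> tangent_set r W"
  by (auto simp: tangent_set_def)

lemma E_times_diff_subset:
  assumes "W' \<subseteq> W" "E_times_diff k r s W f"
  shows "E_times_diff k r s W' f"
  using assms
proof (induction k arbitrary: r s W W' f)
  case 0
  then show ?case
    by (auto intro: continuous_on_subset)
next
  case (Suc k)
  show ?case
    using Suc.prems Suc.IH[OF tangent_set_mono[OF Suc.prems(1)]] by (auto simp: E_times_diff_Suc)
qed

text \<open>In the inductive step the sets \<open>tangent_set r U\<close> are open and cover
  \<open>tangent_set r W\<close>.\<close>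

lemma E_times_diff_local:
  assumes "\<And>x. x \<in> W \<Longrightarrow> \<exists>U. open_in r U \<and> x \<in> U \<and> E_times_diff k r s U f"
  shows "E_times_diff k r s W f"
  using assms
proof (induction k arbitrary: r s W f)
  case 0
  show ?case
    unfolding E_times_diff.simps continuous_on_eq_continuous_within
  proof
    fix x assume "x \<in> W"
    then obtain U where U: "open_in r U" "x \<in> U" "continuous_on U f"
      using 0 by auto
    have "W \<subseteq> E_space r"
      using 0 openin_imp_subset by blast
    moreover have "continuous (at x within E_space r) f"
      using U at_within_open_in[OF U(1,2)] by (auto simp: continuous_on_eq_continuous_within)
    ultimately show "continuous (at x within W) f"
      by (rule continuous_within_subset[rotated])
  qed
next
  case (Suc k)
  have "\<exists>V. open_in (Suc r) V \<and> z \<in> V \<and> E_times_diff k (Suc r) (Suc s) V (E_tangent r s f)"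
    if "z \<in> tangent_set r W" for z
  proof -
    obtain U where "open_in r U" "E_fst r z \<in> U" "E_times_diff (Suc k) r s U f"
      using Suc.prems[of "E_fst r z"] \<open>z \<in> tangent_set r W\<close> by (auto simp: tangent_set_def)
    then show ?thesis
      using that by (intro exI[of _ "tangent_set r U"] conjI)
        (simp_all add: E_times_diff_Suc open_in_tangent_set, simp add: tangent_set_def)
  qed
  then have "E_times_diff k (Suc r) (Suc s) (tangent_set r W) (E_tangent r s f)"
    by (rule Suc.IH)
  moreover have "f differentiable (at x within E_space r)" if "x \<in> W" for x
    using Suc.prems[OF that] by (auto simp: E_times_diff_Suc)
  ultimately show ?case
    by (simp add: E_times_diff_Suc)
qed

text \<open>The chain rule turns T(g \<circ> f) into Tg \<circ> Tf, a composite to which the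
  induction hypothesis applies with one order of differentiability less and all levels raised by
  one.\<close>

lemma E_times_diff_compose:
  assumes "open_in r W" "open_in s V" "f ` W \<subseteq> V"
    and "E_times_diff k r s W f" "E_times_diff k s t V g"
  shows "E_times_diff k r t W (g \<circ> f)"
  using assms
proof (induction k arbitrary: r s t W V f g)
  case 0
  then show ?case
    by (auto simp: comp_def intro: continuous_on_compose2[of V g W f])
next
  case (Suc k)
  have V: "V \<subseteq> E_space s"
    using Suc.prems openin_imp_subset by blast
  then have fW: "f ` W \<subseteq> E_space s"
    using Suc.prems by blast
  have f: "f differentiable (at x within E_space r)" if "x \<in> W" for x
    using that Suc.prems by (auto simp: E_times_diff_Suc)
  have g: "g differentiable (at (f x) within E_space s)" if "x \<in> W" for x
    using that Suc.prems by (auto simp: E_times_diff_Suc)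
  have "E_times_diff k (Suc r) (Suc t) (tangent_set r W) (E_tangent s t g \<circ> E_tangent r s f)"
    by (rule Suc.IH[OF open_in_tangent_set open_in_tangent_set E_tangent_maps])
       (use Suc.prems V in \<open>auto simp: E_times_diff_Suc\<close>)
  moreover have "(E_tangent s t g \<circ> E_tangent r s f) z = E_tangent r t (g \<circ> f) z"
    if "z \<in> tangent_set r W" for z
    unfolding comp_apply[of "E_tangent s t g"]
    by (rule E_tangent_compose[symmetric, OF Suc.prems(1) fW _ _ that]) (fact f g)+
  ultimately have "E_times_diff k (Suc r) (Suc t) (tangent_set r W) (E_tangent r t (g \<circ> f))"
    using E_times_diff_cong[OF open_in_tangent_set[OF Suc.prems(1)]] by blast
  moreover have "(g \<circ> f) differentiable (at x within E_space r)" if "x \<in> W" for x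
    using has_derivative_compose_in[OF Suc.prems(1) that fW f[OF that, unfolded frechet_derivative_works]
          g[OF that, unfolded frechet_derivative_works]]
    unfolding differentiable_def comp_def by blast
  ultimately show ?case
    unfolding E_times_diff_Suc by blast
qed

lemma E_times_diff_linear:
  assumes "bounded_linear L" "open_in r W"
  shows "E_times_diff k r s W L"
  using assms
proof (induction k arbitrary: r s W L)
  case 0
  then show ?case
    by (simp add: linear_continuous_on)
next
  case (Suc k)
  have "E_times_diff k (Suc r) (Suc s) (tangent_set r W) (E_tangent r s L)"
    by (rule E_times_diff_cong[of _ _ "lin_tangent r s L"])
       (simp_all add: open_in_tangent_set Suc bounded_linear_lin_tangent E_tangent_linear)
  then show ?case
    by (simp add: E_times_diff_Suc Suc bounded_linear_differentiable)
qed

lemma E_smooth_on_cong: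
  "open_in r W \<Longrightarrow> (\<And>x. x \<in> W \<Longrightarrow> f x = g x) \<Longrightarrow> E_smooth_on r s W f \<Longrightarrow> E_smooth_on r s W g"
  unfolding E_smooth_on_def using E_times_diff_cong by blast

lemma E_smooth_on_subset: "W' \<subseteq> W \<Longrightarrow> E_smooth_on r s W f \<Longrightarrow> E_smooth_on r s W' f"
  unfolding E_smooth_on_def using E_times_diff_subset by blast

lemma E_smooth_on_local:
  "(\<And>x. x \<in> W \<Longrightarrow> \<exists>U. open_in r U \<and> x \<in> U \<and> E_smooth_on r s U f) \<Longrightarrow> E_smooth_on r s W f"
  unfolding E_smooth_on_def by (intro allI E_times_diff_local) blast

lemma E_smooth_on_compose:
  assumes "open_in r W" "open_in s V" "f ` W \<subseteq> V" "E_smooth_on r s W f" "E_smooth_on s t V g"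
  shows "E_smooth_on r t W (g \<circ> f)"
  using assms(4,5) E_times_diff_compose[OF assms(1-3)] unfolding E_smooth_on_def by blast

lemma E_smooth_on_linear: "bounded_linear L \<Longrightarrow> open_in r W \<Longrightarrow> E_smooth_on r s W L"
  unfolding E_smooth_on_def using E_times_diff_linear by blast

lemma E_smooth_on_tangent:
  "E_smooth_on r s W f \<Longrightarrow> E_smooth_on (Suc r) (Suc s) (tangent_set r W) (E_tangent r s f)"
  unfolding E_smooth_on_def using E_times_diff_Suc by blast

lemma E_smooth_on_differentiable:
  "E_smooth_on r s W f \<Longrightarrow> x \<in> W \<Longrightarrow> f differentiable (at x within E_space r)"
  unfolding E_smooth_on_def using E_times_diff_Suc by blast

lemma E_smooth_on_continuous: "E_smooth_on r s W f \<Longrightarrow> continuous_on W f"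
  unfolding E_smooth_on_def using E_times_diff.simps(1) by blast

section \<open>Iterated directional derivatives\<close>

primrec iter_tangent ::
  "nat \<Rightarrow> nat \<Rightarrow> nat \<Rightarrow> ((nat \<Rightarrow>\<^sub>0 'e::real_normed_vector) \<Rightarrow> (nat \<Rightarrow>\<^sub>0 'f::real_normed_vector))
     \<Rightarrow> (nat \<Rightarrow>\<^sub>0 'e) \<Rightarrow> (nat \<Rightarrow>\<^sub>0 'f)" where
  "iter_tangent 0 r s f = f"
| "iter_tangent (Suc k) r s f = E_tangent (r + k) (s + k) (iter_tangent k r s f)"

primrec iter_set :: "nat \<Rightarrow> nat \<Rightarrow> (nat \<Rightarrow>\<^sub>0 'e::real_normed_vector) set \<Rightarrow> (nat \<Rightarrow>\<^sub>0 'e) set" where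
  "iter_set 0 r W = W"
| "iter_set (Suc k) r W = tangent_set (r + k) (iter_set k r W)"

text \<open>Each direction \<open>h k\<close> lies in E_r and enters E_(r+k) through the nesting of
  the model spaces, that is, with all components zero except the base one. Therefore it varies
  \<open>x\<close> alone and leaves the earlier directions fixed, and no lower order terms appear in
  the top component.\<close>

primrec iter_point :: "nat \<Rightarrow> nat \<Rightarrow> (nat \<Rightarrow>\<^sub>0 'e::real_normed_vector) \<Rightarrow> (nat \<Rightarrow> nat \<Rightarrow>\<^sub>0 'e) \<Rightarrow> (nat \<Rightarrow>\<^sub>0 'e)" where
  "iter_point 0 r x h = x"
| "iter_point (Suc k) r x h = E_pair (r + k) (iter_point k r x h) (h k)"

primrec top_component :: "nat \<Rightarrow> nat \<Rightarrow> (nat \<Rightarrow>\<^sub>0 'f::real_normed_vector) \<Rightarrow> (nat \<Rightarrow>\<^sub>0 'f)" where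
  "top_component 0 s y = y"
| "top_component (Suc k) s y = top_component k s (E_snd (s + k) y)"

text \<open>
  The \<open>k\<close>-th derivative of \<open>f\<close> at \<open>x\<close> in the directions \<open>h 0, ..., h (k-1)\<close> is the top
  component of the \<open>k\<close>-fold tangent map at a point which depends affinely on \<open>x\<close>, with linear
  part the inclusion of \<open>E_r\<close> in \<open>E_(r+k)\<close>.
\<close>

definition dir_deriv ::
  "nat \<Rightarrow> nat \<Rightarrow> nat \<Rightarrow> ((nat \<Rightarrow>\<^sub>0 'e::real_normed_vector) \<Rightarrow> (nat \<Rightarrow>\<^sub>0 'f::real_normed_vector))
     \<Rightarrow> (nat \<Rightarrow>\<^sub>0 'e) \<Rightarrow> (nat \<Rightarrow> nat \<Rightarrow>\<^sub>0 'e) \<Rightarrow> (nat \<Rightarrow>\<^sub>0 'f)" where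
  "dir_deriv k r s f x h = top_component k s (iter_tangent k r s f (iter_point k r x h))"

lemma open_in_iter_set: "open_in r W \<Longrightarrow> open_in (r + k) (iter_set k r W)"
  by (induction k) (auto simp: open_in_tangent_set)

lemma E_smooth_on_iter_tangent:
  "E_smooth_on r s W f \<Longrightarrow> E_smooth_on (r + k) (s + k) (iter_set k r W) (iter_tangent k r s f)"
  by (induction k) (auto simp: E_smooth_on_tangent)

lemma iter_tangent_in:
  "f ` W \<subseteq> E_space s \<Longrightarrow> iter_tangent k r s f ` iter_set k r W \<subseteq> E_space (s + k)"
  by (cases k) auto

lemma iter_point_in_iter_set:
  "x \<in> W \<Longrightarrow> open_in r W \<Longrightarrow> range h \<subseteq> E_space r \<Longrightarrow> iter_point k r x h \<in> iter_set k r W"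
proof (induction k)
  case (Suc k)
  then have "iter_point k r x h \<in> E_space (r + k)"
    using openin_imp_subset[OF open_in_iter_set] by blast
  with Suc show ?case
    by (simp add: tangent_set_def)
qed simp

lemma E_pair_add: "v \<in> E_space r \<Longrightarrow> E_pair r (x + v) y = E_pair r x y + v"
  by (rule poly_mapping_eqI) (auto simp: lookup_E_pair lookup_add E_space_def)

lemma iter_point_add:
  assumes "v \<in> E_space r"
  shows "iter_point k r (x + v) h = iter_point k r x h + v"
proof (induction k)
  case (Suc k)
  have "v \<in> E_space (r + k)"
    using assms E_space_mono[of r "r + k"] by auto
  with Suc show ?case
    by (simp add: E_pair_add)
qed simp

lemma bounded_linear_top_component: "bounded_linear (top_component k s)"
  by (induction k) (auto intro: bounded_linear_compose[OF _ bounded_linear_E_snd] simp: bounded_linear_ident)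

lemma continuous_on_iter_point:
  "continuous_on A x \<Longrightarrow> (\<And>j. continuous_on A (\<lambda>a. h a j)) \<Longrightarrow> continuous_on A (\<lambda>a. iter_point k r (x a) (h a))"
  by (induction k) (auto intro!: continuous_on_E_pair)

lemma dir_deriv_0 [simp]: "dir_deriv 0 r s f x h = f x"
  by (simp add: dir_deriv_def)

lemma continuous_on_dir_deriv:
  assumes W: "open_in r W" and f: "E_smooth_on r s W f"
    and x: "continuous_on A x" "x ` A \<subseteq> W"
    and h: "\<And>j. continuous_on A (\<lambda>a. h a j)" "\<And>a. a \<in> A \<Longrightarrow> range (h a) \<subseteq> E_space r"
  shows "continuous_on A (\<lambda>a. dir_deriv k r s f (x a) (h a))"
proof -
  have "continuous_on A (\<lambda>a. iter_tangent k r s f (iter_point k r (x a) (h a)))"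
  proof (rule continuous_on_compose2[OF E_smooth_on_continuous[OF E_smooth_on_iter_tangent[OF f]]])
    show "continuous_on A (\<lambda>a. iter_point k r (x a) (h a))"
      by (intro continuous_on_iter_point x h)
    show "(\<lambda>a. iter_point k r (x a) (h a)) ` A \<subseteq> iter_set k r W"
      using iter_point_in_iter_set[OF _ W] x h by blast
  qed
  then show ?thesis
    unfolding dir_deriv_def by (rule bounded_linear.continuous_on[OF bounded_linear_top_component])
qed

text \<open>Replacing x by x + t h_k translates the point \<open>p\<close> by t h_k
  (\<open>iter_point_add\<close>). So the derivative at t = 0 is that of the k-fold tangent map at
  \<open>p\<close> in direction h_k, which is the second half of its tangent map at (p, h_k), the
  point used for order k + 1.\<close>

lemma dir_deriv_has_vector_derivative:
  assumes W: "open_in r W" and f: "E_smooth_on r s W f" "f ` W \<subseteq> E_space s"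
    and x: "x \<in> W" and h: "range h \<subseteq> E_space r"
  shows "((\<lambda>t. dir_deriv k r s f (x + t *\<^sub>R h k) h) has_vector_derivative dir_deriv (Suc k) r s f x h) (at 0)"
proof -
  define F where "F = iter_tangent k r s f"
  define p where "p = iter_point k r x h"
  have hk: "h k \<in> E_space r" "h k \<in> E_space (r + k)"
    using h E_space_mono[of r "r + k"] by auto
  have p: "p \<in> iter_set k r W" "open_in (r + k) (iter_set k r W)"
    unfolding p_def using iter_point_in_iter_set W x h open_in_iter_set by blast+
  have pr: "p \<in> E_space (r + k)"
    using p openin_imp_subset by blast
  have F: "F differentiable (at p within E_space (r + k))"
    unfolding F_def by (rule E_smooth_on_differentiable[OF E_smooth_on_iter_tangent[OF f(1)] p(1)])
  have Fp: "F p \<in> E_space (s + k)" "deriv_in (r + k) F p (h k) \<in> E_space (s + k)"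
    using p(1) iter_tangent_in[OF f(2), of k r] deriv_in_space[OF p(2,1) _ F hk(2), of "s + k"]
    unfolding F_def by blast+
  have *: "dir_deriv k r s f (x + t *\<^sub>R h k) h = top_component k s (F (p + t *\<^sub>R h k))" for t
    using hk(1) subspace_E_space unfolding dir_deriv_def F_def p_def
    by (subst iter_point_add) (auto intro: subspace_scale)
  have "((\<lambda>t::real. F (p + t *\<^sub>R h k)) has_vector_derivative deriv_in (r + k) F p (h k)) (at 0)"
    unfolding has_vector_derivative_def
    by (rule has_derivative_along_line[OF F[unfolded frechet_derivative_works] pr hk(2)])
  then have "((\<lambda>t. top_component k s (F (p + t *\<^sub>R h k))) has_vector_derivative
      top_component k s (deriv_in (r + k) F p (h k))) (at 0)"
    by (rule bounded_linear.has_vector_derivative[OF bounded_linear_top_component])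
  moreover have "dir_deriv (Suc k) r s f x h = top_component k s (deriv_in (r + k) F p (h k))"
    using Fp pr hk by (simp add: dir_deriv_def F_def[symmetric] p_def[symmetric] E_tangent_pair)
  ultimately show ?thesis
    by (simp add: *)
qed

section \<open>Symmetry of the second derivative\<close>

lemma vector_derivative_norm_bound:
  fixes F :: "real \<Rightarrow> 'v::real_normed_vector"
  assumes "a \<le> b" and F: "\<And>x. x \<in> {a..b} \<Longrightarrow> (F has_vector_derivative F' x) (at x)"
    and B: "\<And>x. x \<in> {a..b} \<Longrightarrow> norm (F' x) \<le> B"
  shows "norm (F b - F a) \<le> B * (b - a)"
proof -
  have "norm (F b - F a) \<le> B * norm (b - a)"
  proof (rule differentiable_bound[where S = "{a..b}" and f' = "\<lambda>x t. t *\<^sub>R F' x"])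
    show "(F has_derivative (\<lambda>t. t *\<^sub>R F' x)) (at x within {a..b})" if "x \<in> {a..b}" for x
      using F[OF that] unfolding has_vector_derivative_def by (rule has_derivative_at_withinI)
    show "onorm (\<lambda>t. t *\<^sub>R F' x) \<le> B" if "x \<in> {a..b}" for x
      using B[OF that] by (intro onorm_le) (simp add: mult.commute[of B] mult_left_mono)
  qed (use assms(1) in auto)
  then show ?thesis
    using assms(1) by simp
qed

text \<open>The mean value inequality twice: first in t for gs s t - t c, which bounds the
  s-derivative of g s h - g s 0 - s h c, then in s for the latter.\<close>

lemma second_difference_bound:
  fixes g :: "real \<Rightarrow> real \<Rightarrow> 'v::real_normed_vector"
  assumes "0 < h"
    and gs: "\<And>s t. s \<in> {0..h} \<Longrightarrow> t \<in> {0..h} \<Longrightarrow> ((\<lambda>s. g s t) has_vector_derivative gs s t) (at s)"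
    and gst: "\<And>s t. s \<in> {0..h} \<Longrightarrow> t \<in> {0..h} \<Longrightarrow> ((\<lambda>t. gs s t) has_vector_derivative gst s t) (at t)"
    and e: "\<And>s t. s \<in> {0..h} \<Longrightarrow> t \<in> {0..h} \<Longrightarrow> norm (gst s t - c) \<le> e"
  shows "norm (g h h - g h 0 - (g 0 h - g 0 0) - (h * h) *\<^sub>R c) \<le> e * h * h"
proof -
  have 1: "norm (gs s h - gs s 0 - h *\<^sub>R c) \<le> e * h" if s: "s \<in> {0..h}" for s
  proof -
    have "norm ((gs s h - h *\<^sub>R c) - (gs s 0 - 0 *\<^sub>R c)) \<le> e * (h - 0)"
      by (rule vector_derivative_norm_bound[where F' = "\<lambda>t. gst s t - 1 *\<^sub>R c"])
         (use assms s in \<open>auto intro!: derivative_eq_intros gst\<close>)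
    then show ?thesis
      by (simp add: algebra_simps)
  qed
  have "norm ((g h h - g h 0 - h *\<^sub>R (h *\<^sub>R c)) - (g 0 h - g 0 0 - 0 *\<^sub>R (h *\<^sub>R c))) \<le> e * h * (h - 0)"
    by (rule vector_derivative_norm_bound[where F' = "\<lambda>s. gs s h - gs s 0 - 1 *\<^sub>R (h *\<^sub>R c)"])
       (use assms 1 in \<open>auto intro!: derivative_eq_intros gs\<close>)
  then show ?thesis
    by (simp add: algebra_simps)
qed

text \<open>The second difference \<Delta> is symmetric in the two variables, and it equals h^2
  times either mixed derivative at the origin up to an error of (e/2) h^2. Dividing by h^2 leaves a
  difference of at most \<open>e\<close>.\<close>

lemma mixed_derivatives_eq:
  fixes g :: "real \<Rightarrow> real \<Rightarrow> 'v::real_normed_vector"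
  assumes "0 < d"
    and gs: "\<And>s t. \<bar>s\<bar> < d \<Longrightarrow> \<bar>t\<bar> < d \<Longrightarrow> ((\<lambda>s. g s t) has_vector_derivative gs s t) (at s)"
    and gst: "\<And>s t. \<bar>s\<bar> < d \<Longrightarrow> \<bar>t\<bar> < d \<Longrightarrow> ((\<lambda>t. gs s t) has_vector_derivative gst s t) (at t)"
    and gt: "\<And>s t. \<bar>s\<bar> < d \<Longrightarrow> \<bar>t\<bar> < d \<Longrightarrow> ((\<lambda>t. g s t) has_vector_derivative gt s t) (at t)"
    and gts: "\<And>s t. \<bar>s\<bar> < d \<Longrightarrow> \<bar>t\<bar> < d \<Longrightarrow> ((\<lambda>s. gt s t) has_vector_derivative gts s t) (at s)"
    and cont: "isCont (\<lambda>(s, t). gst s t) (0, 0)" "isCont (\<lambda>(s, t). gts s t) (0, 0)"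
  shows "gst 0 0 = gts 0 0"
proof -
  have small: "\<exists>d'>0. \<forall>s t. \<bar>s\<bar> < d' \<longrightarrow> \<bar>t\<bar> < d' \<longrightarrow> norm (G s t - G 0 0) \<le> e"
    if G: "isCont (\<lambda>(s, t). G s t) (0::real, 0::real)" and e: "e > 0" for G :: "real \<Rightarrow> real \<Rightarrow> 'v" and e
  proof -
    obtain d' where d': "d' > 0" "\<And>p. dist p (0, 0) < d' \<Longrightarrow> dist ((\<lambda>(s, t). G s t) p) (G 0 0) < e"
      using G e unfolding continuous_at_eps_delta by force
    \<comment> \<open>Half of \<open>d'\<close> turns the ball of the product metric into a square,
      as the distance to the origin is at most |s| + |t|.\<close>
    have "norm (G s t - G 0 0) \<le> e" if "\<bar>s\<bar> < d' / 2" "\<bar>t\<bar> < d' / 2" for s t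
    proof -
      have "dist (s, t) (0, 0) \<le> \<bar>s\<bar> + \<bar>t\<bar>"
        by (simp add: dist_Pair_Pair dist_real_def sqrt_sum_squares_le_sum_abs)
      then show ?thesis
        using d'(2)[of "(s, t)"] that by (simp add: dist_norm less_imp_le)
    qed
    then show ?thesis
      using d'(1) by (intro exI[of _ "d' / 2"]) auto
  qed
  have "norm (gst 0 0 - gts 0 0) \<le> e" if e: "e > 0" for e
  proof -
    obtain d1 where d1: "d1 > 0" "\<And>s t. \<bar>s\<bar> < d1 \<Longrightarrow> \<bar>t\<bar> < d1 \<Longrightarrow> norm (gst s t - gst 0 0) \<le> e / 2"
      using small[OF cont(1) half_gt_zero[OF e]] by blast
    obtain d2 where d2: "d2 > 0" "\<And>s t. \<bar>s\<bar> < d2 \<Longrightarrow> \<bar>t\<bar> < d2 \<Longrightarrow> norm (gts s t - gts 0 0) \<le> e / 2"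
      using small[OF cont(2) half_gt_zero[OF e]] by blast
    define h where "h = Min {d, d1, d2} / 2"
    have h: "0 < h" "h < d" "h < d1" "h < d2"
      using assms(1) d1(1) d2(1) by (auto simp: h_def)
    define \<Delta> where "\<Delta> = g h h - g h 0 - (g 0 h - g 0 0)"
    have 1: "norm (\<Delta> - (h * h) *\<^sub>R gst 0 0) \<le> e / 2 * h * h"
      unfolding \<Delta>_def using h by (intro second_difference_bound[of h g gs gst] gs gst d1) auto
    \<comment> \<open>Exchanging the roles of s and t only rearranges the four terms of
      \<Delta>.\<close>
    have "norm (g h h - g 0 h - (g h 0 - g 0 0) - (h * h) *\<^sub>R gts 0 0) \<le> e / 2 * h * h"
      using h by (intro second_difference_bound[of h "\<lambda>t s. g s t" "\<lambda>t s. gt s t" "\<lambda>t s. gts s t"] gt gts d2) auto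
    then have 2: "norm (\<Delta> - (h * h) *\<^sub>R gts 0 0) \<le> e / 2 * h * h"
      by (simp add: \<Delta>_def algebra_simps)
    have "(h * h) * norm (gst 0 0 - gts 0 0) = norm ((\<Delta> - (h * h) *\<^sub>R gts 0 0) - (\<Delta> - (h * h) *\<^sub>R gst 0 0))"
      by (simp add: algebra_simps flip: scaleR_diff_right)
    also have "\<dots> \<le> e / 2 * h * h + e / 2 * h * h"
      using norm_triangle_ineq4 1 2 by (meson add_mono order_trans)
    also have "\<dots> = (h * h) * e"
      by (simp add: algebra_simps)
    finally show ?thesis
      using h by simp
  qed
  then have "norm (gst 0 0 - gts 0 0) \<le> 0"
    by (rule field_le_epsilon) simp
  then show ?thesis
    by simp
qed

text \<open>On the plane (a, b) \<mapsto> x + a u + b v these are the two mixed partial derivatives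
  of \<open>f\<close> at the origin: \<open>hu\<close> differentiates along \<open>u\<close> first,
  \<open>hv\<close> along \<open>v\<close> first.\<close>

lemma dir_deriv_2_commute:
  assumes W: "open_in r W" and f: "E_smooth_on r s W f" "f ` W \<subseteq> E_space s"
    and x: "x \<in> W" and u: "u \<in> E_space r" and v: "v \<in> E_space r"
  shows "dir_deriv 2 r s f x (\<lambda>j. if j = 0 then u else v) = dir_deriv 2 r s f x (\<lambda>j. if j = 0 then v else u)"
proof -
  define p where "p a b = x + a *\<^sub>R u + b *\<^sub>R v" for a b :: real
  define hu where "hu = (\<lambda>j::nat. if j = 0 then u else v)"
  define hv where "hv = (\<lambda>j::nat. if j = 0 then v else u)"
  have hr: "range hu \<subseteq> E_space r" "range hv \<subseteq> E_space r"
    using u v by (auto simp: hu_def hv_def)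
  have pr: "p a b \<in> E_space r" for a b
    using x u v openin_imp_subset[OF W] subspace_E_space[of r] unfolding p_def
    by (auto intro!: subspace_add subspace_scale)
  obtain T where T: "open T" "W = E_space r \<inter> T"
    using W by (auto simp: openin_open)
  define U where "U = (\<lambda>(a, b). p a b) -` T"
  have U: "open U" "(0, 0) \<in> U"
    using T x unfolding U_def p_def case_prod_beta
    by (auto intro!: open_vimage continuous_intros)
  obtain d where d: "d > 0" "ball (0, 0) d \<subseteq> U"
    using U open_contains_ball by blast
  have pW: "p a b \<in> W" if "\<bar>a\<bar> < d / 2" "\<bar>b\<bar> < d / 2" for a b
  proof -
    have "dist (0, 0) (a, b) \<le> \<bar>a\<bar> + \<bar>b\<bar>"
      by (simp add: dist_Pair_Pair dist_real_def sqrt_sum_squares_le_sum_abs)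
    then have "(a, b) \<in> U"
      using that d by (intro subsetD[OF d(2)]) simp
    then show ?thesis
      using T pr by (simp add: U_def)
  qed
  \<comment> \<open>\<open>dir_deriv_has_vector_derivative\<close> speaks of parameter 0 only. Since
    p a b + t u = p (a + t) b, and likewise for v, a translation gives the derivative at every
    parameter.\<close>
  have shift: "(\<phi> has_vector_derivative c) (at a)"
    if "((\<lambda>t. \<phi> (a + t)) has_vector_derivative c) (at 0)" for \<phi> :: "real \<Rightarrow> nat \<Rightarrow>\<^sub>0 'b" and a c
  proof -
    have "((\<lambda>t. t - a) has_vector_derivative 1) (at a)"
      by (auto intro!: derivative_eq_intros)
    then have "((\<lambda>t. \<phi> (a + t)) \<circ> (\<lambda>t. t - a) has_vector_derivative 1 *\<^sub>R c) (at a)"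
      using that by (intro vector_diff_chain_at) auto
    then show ?thesis
      by (simp add: comp_def)
  qed
  have cont: "isCont (\<lambda>(a, b). dir_deriv 2 r s f (p a b) h) (0, 0)" if "range h \<subseteq> E_space r" for h
  proof -
    have "continuous_on U (\<lambda>z. dir_deriv 2 r s f (p (fst z) (snd z)) h)"
      using that pr T
      by (intro continuous_on_dir_deriv[OF W f(1)])
         (auto simp: U_def p_def intro!: continuous_intros)
    then show ?thesis
      using U by (simp add: case_prod_unfold continuous_on_eq_continuous_at)
  qed
  have "dir_deriv 2 r s f (p 0 0) hu = dir_deriv 2 r s f (p 0 0) hv"
  proof (rule mixed_derivatives_eq[where d = "d / 2" and g = "\<lambda>a b. f (p a b)"
        and gs = "\<lambda>a b. dir_deriv 1 r s f (p a b) hu" and gst = "\<lambda>a b. dir_deriv 2 r s f (p a b) hu"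
        and gt = "\<lambda>a b. dir_deriv 1 r s f (p a b) hv" and gts = "\<lambda>a b. dir_deriv 2 r s f (p a b) hv"])
    fix a b :: real assume ab: "\<bar>a\<bar> < d / 2" "\<bar>b\<bar> < d / 2"
    note der = dir_deriv_has_vector_derivative[OF W f pW[OF ab]]
    show "((\<lambda>a. f (p a b)) has_vector_derivative dir_deriv 1 r s f (p a b) hu) (at a)"
      by (rule shift) (use der[OF hr(1), of 0] in \<open>simp add: p_def hu_def algebra_simps\<close>)
    show "((\<lambda>b. dir_deriv 1 r s f (p a b) hu) has_vector_derivative dir_deriv 2 r s f (p a b) hu) (at b)"
      by (rule shift) (use der[OF hr(1), of 1] in \<open>simp add: p_def hu_def algebra_simps numeral_2_eq_2\<close>)
    show "((\<lambda>b. f (p a b)) has_vector_derivative dir_deriv 1 r s f (p a b) hv) (at b)"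
      by (rule shift) (use der[OF hr(2), of 0] in \<open>simp add: p_def hv_def algebra_simps\<close>)
    show "((\<lambda>a. dir_deriv 1 r s f (p a b) hv) has_vector_derivative dir_deriv 2 r s f (p a b) hv) (at a)"
      by (rule shift) (use der[OF hr(2), of 1] in \<open>simp add: p_def hv_def algebra_simps numeral_2_eq_2\<close>)
  qed (use cont hr d in auto)
  then show ?thesis
    by (simp add: p_def hu_def hv_def)
qed

text \<open>The map (x, y) \<mapsto> (f x, Df(x) y) is differentiated in the direction (X, Y) = (X,
  0) + (0, Y). Its second component contributes the second derivative of \<open>f\<close> along (X,
  0) and the linear map Df(x) along (0, Y).\<close>

lemma E_tangent_tangent_pair:
  assumes W: "open_in r W" and f: "E_smooth_on r s W f" "f ` W \<subseteq> E_space s"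
    and x: "x \<in> W" and y: "y \<in> E_space r" and X: "X \<in> E_space r" and Y: "Y \<in> E_space r"
  shows "E_tangent (Suc r) (Suc s) (E_tangent r s f) (E_pair (Suc r) (E_pair r x y) (E_pair r X Y))
    = E_pair (Suc s) (E_pair s (f x) (deriv_in r f x y))
        (E_pair s (deriv_in r f x X)
           (dir_deriv 2 r s f x (\<lambda>j. if j = 0 then y else X) + deriv_in r f x Y))"
proof -
  define z where "z = E_pair r x y"
  define G where "G = E_tangent r s f"
  define D where "D = deriv_in (Suc r) G z"
  have xr: "x \<in> E_space r"
    using x openin_imp_subset[OF W] by blast
  have z: "z \<in> tangent_set r W" "E_fst r z = x"
    using x y xr by (auto simp: z_def tangent_set_def)
  have zr: "z \<in> E_space (Suc r)"
    by (simp add: z_def)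
  have X': "X \<in> E_space (Suc r)"
    using X E_space_mono[of r "Suc r"] by auto
  have fx: "f differentiable (at x within E_space r)" "f x \<in> E_space s"
    using E_smooth_on_differentiable[OF f(1) x] f(2) x by auto
  then have df: "(f has_derivative deriv_in r f x) (at x within E_space r)"
    by (simp add: frechet_derivative_works)
  have dfs: "deriv_in r f x v \<in> E_space s" if "v \<in> E_space r" for v
    by (rule deriv_in_space[OF W x f(2) fx(1) that])
  have G: "(G has_derivative D) (at z within E_space (Suc r))"
    using E_smooth_on_differentiable[OF E_smooth_on_tangent[OF f(1)] z(1)]
    by (simp add: G_def D_def frechet_derivative_works)
  then have lin: "linear D"
    by (rule has_derivative_linear)
  have Ds: "D v \<in> E_space (Suc s)" if "v \<in> E_space (Suc r)" for v
    by (rule has_derivative_in_space[OF open_in_tangent_set[OF W] z(1) _ G that]) (auto simp: G_def)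
  have fst: "E_fst s (D v) = deriv_in r f x (E_fst r v)" if v: "v \<in> E_space (Suc r)" for v
  proof -
    have "((\<lambda>w. f (E_fst r w)) has_derivative (\<lambda>v. deriv_in r f x (E_fst r v))) (at z within E_space (Suc r))"
      by (rule has_derivative_compose_in[OF open_in_tangent_set[OF W] z(1) _
            bounded_linear_imp_has_derivative[OF bounded_linear_E_fst]])
         (use df z(2) in auto)
    moreover have "f (E_fst r w) = E_fst s (G w)" if "w \<in> tangent_set r W" for w
      using that f(2) unfolding G_def by (subst E_fst_E_tangent) (auto simp: tangent_set_def)
    ultimately have "((\<lambda>w. E_fst s (G w)) has_derivative (\<lambda>v. deriv_in r f x (E_fst r v))) (at z within E_space (Suc r))"
      by (rule has_derivative_cong_open_in[OF open_in_tangent_set[OF W] z(1), rotated])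
    moreover have "((\<lambda>w. E_fst s (G w)) has_derivative (\<lambda>v. E_fst s (D v))) (at z within E_space (Suc r))"
      by (rule bounded_linear.has_derivative[OF bounded_linear_E_fst G])
    ultimately show ?thesis
      using deriv_in_eq zr v by metis
  qed
  \<comment> \<open>Through the nesting of the model spaces \<open>X\<close> is the direction (X,
    0), and (z, X) is exactly the point that \<open>iter_point\<close> builds for order 2.\<close>
  have snd_X: "E_snd s (D X) = dir_deriv 2 r s f x (\<lambda>j. if j = 0 then y else X)"
    using Ds[OF X'] X' zr
    by (simp add: dir_deriv_def numeral_2_eq_2 G_def[symmetric] z_def[symmetric] D_def[symmetric] E_tangent_pair)
  \<comment> \<open>With x fixed the second component of \<open>G\<close> is the linear map Df(x) in
    y, which is its own derivative.\<close>
  have snd_Y: "E_snd s (D (E_pair r 0 Y)) = deriv_in r f x Y"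
  proof -
    have "((\<lambda>t::real. G (z + t *\<^sub>R E_pair r 0 Y)) has_derivative (\<lambda>t. t *\<^sub>R D (E_pair r 0 Y))) (at 0)"
      by (rule has_derivative_along_line[OF G zr]) simp
    from bounded_linear.has_derivative[OF bounded_linear_E_snd this]
    have "((\<lambda>t::real. E_snd s (G (z + t *\<^sub>R E_pair r 0 Y))) has_derivative
        (\<lambda>t. E_snd s (t *\<^sub>R D (E_pair r 0 Y)))) (at 0)" .
    moreover have "E_snd s (G (z + t *\<^sub>R E_pair r 0 Y)) = deriv_in r f x y + t *\<^sub>R deriv_in r f x Y" for t
    proof -
      have "z + t *\<^sub>R E_pair r 0 Y = E_pair r x (y + t *\<^sub>R Y)"
        unfolding z_def by (rule poly_mapping_eqI) (auto simp: lookup_E_pair lookup_add lookup_scaleR)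
      moreover have *: "y + t *\<^sub>R Y \<in> E_space r"
        using y Y subspace_E_space by (auto intro: subspace_add subspace_scale)
      ultimately have "E_snd s (G (z + t *\<^sub>R E_pair r 0 Y)) = deriv_in r f x (y + t *\<^sub>R Y)"
        using xr dfs[OF *] by (simp add: G_def E_tangent_pair)
      then show ?thesis
        using has_derivative_linear[OF df] by (simp add: linear_add linear_scale)
    qed
    then have "((\<lambda>t::real. E_snd s (G (z + t *\<^sub>R E_pair r 0 Y))) has_derivative
        (\<lambda>t. t *\<^sub>R deriv_in r f x Y)) (at 0)"
      by (auto intro!: derivative_eq_intros)
    ultimately have "(\<lambda>t::real. E_snd s (t *\<^sub>R D (E_pair r 0 Y))) = (\<lambda>t. t *\<^sub>R deriv_in r f x Y)"
      by (rule has_derivative_unique)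
    then show ?thesis
      by (metis scaleR_one)
  qed
  have XY: "E_pair r X Y = E_pair r 0 Y + X"
    using E_pair_add[OF X, of 0 Y] by simp
  have "E_snd s (D (E_pair r X Y)) = E_snd s (D (E_pair r 0 Y)) + E_snd s (D X)"
    unfolding XY using lin by (simp add: linear_add bounded_linear.linear[OF bounded_linear_E_snd])
  moreover have "E_fst s (D (E_pair r X Y)) = deriv_in r f x X"
    using fst[of "E_pair r X Y"] X by simp
  ultimately have "D (E_pair r X Y) = E_pair s (deriv_in r f x X)
      (dir_deriv 2 r s f x (\<lambda>j. if j = 0 then y else X) + deriv_in r f x Y)"
    using E_pair_fst_snd[OF Ds, of "E_pair r X Y"] snd_X snd_Y by (simp add: add.commute)
  moreover have "G z = E_pair s (f x) (deriv_in r f x y)"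
    unfolding G_def z_def by (rule E_tangent_pair[OF xr y])
  ultimately show ?thesis
    using zr by (simp add: E_tangent_pair G_def[symmetric] z_def[symmetric] D_def[symmetric])
qed

text \<open>Exchanging y and X in the formula of \<open>E_tangent_tangent_pair\<close> exchanges the
  two middle components; the last one is unchanged because the second derivative is
  symmetric.\<close>

lemma E_tangent_tangent_E_flip:
  assumes W: "open_in r W" and f: "E_smooth_on r s W f" "f ` W \<subseteq> E_space s"
    and z: "z \<in> tangent_set (Suc r) (tangent_set r W)"
  shows "E_tangent (Suc r) (Suc s) (E_tangent r s f) (E_flip r z)
       = E_flip s (E_tangent (Suc r) (Suc s) (E_tangent r s f) z)"
proof -
  have "z \<in> E_space (Suc (Suc r))"
    using z by (simp add: tangent_set_def)
  then obtain x y X Y where zeq: "z = E_pair (Suc r) (E_pair r x y) (E_pair r X Y)"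
    and r: "x \<in> E_space r" "y \<in> E_space r" "X \<in> E_space r" "Y \<in> E_space r"
    by (rule E_space_Suc_Suc_cases)
  have x: "x \<in> W"
    using z r by (simp add: zeq tangent_set_def)
  have fx: "f differentiable (at x within E_space r)" "f x \<in> E_space s"
    using E_smooth_on_differentiable[OF f(1) x] f(2) x by auto
  note dfs = deriv_in_space[OF W x f(2) fx(1)]
  define b where "b y X = dir_deriv 2 r s f x (\<lambda>j. if j = 0 then y else X)" for y X
  have b: "b y X \<in> E_space s"
  proof -
    have "b y X = E_snd s (E_snd (Suc s) (iter_tangent 2 r s f (iter_point 2 r x (\<lambda>j. if j = 0 then y else X))))"
      by (simp add: b_def dir_deriv_def numeral_2_eq_2)
    then show ?thesis
      by simp
  qed
  have sum: "b y X + deriv_in r f x Y \<in> E_space s"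
    using b dfs[OF r(4)] subspace_E_space by (intro subspace_add)
  have "b X y = b y X"
    unfolding b_def by (rule dir_deriv_2_commute[OF W f x r(3,2)])
  then show ?thesis
    using E_tangent_tangent_pair[OF W f x r(2,3,4)] E_tangent_tangent_pair[OF W f x r(3,2,4)]
      dfs[OF r(2)] dfs[OF r(3)] fx(2) sum r
    by (simp add: zeq E_flip_pair b_def[symmetric])
qed

section \<open>Tangent bundles of manifolds modeled on the spaces \<open>E_r\<close>\<close>

text \<open>The atlas conditions over \<open>E_space r\<close> that pass to the tangent bundle
  (\<open>E_manifold_TN\<close>), so that induction gives them on every T^rM.\<close>

locale E_manifold =
  fixes r :: nat and N :: "('a, 'i, 'e::real_normed_vector) tmfd"
  assumes model_eq: "model N = E_space r"
    and points_eq: "points N = (\<Union>\<alpha>\<in>index N. cdom N \<alpha>)"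
    and inj_chart: "\<alpha> \<in> index N \<Longrightarrow> inj_on (chart N \<alpha>) (cdom N \<alpha>)"
    and open_overlap: "\<alpha> \<in> index N \<Longrightarrow> \<beta> \<in> index N \<Longrightarrow> open_in r (chart N \<alpha> ` (cdom N \<alpha> \<inter> cdom N \<beta>))"
    and smooth_transition: "\<alpha> \<in> index N \<Longrightarrow> \<beta> \<in> index N \<Longrightarrow>
      E_smooth_on r r (chart N \<alpha> ` (cdom N \<alpha> \<inter> cdom N \<beta>)) (chart N \<beta> \<circ> chart_inv N \<alpha>)"
begin

abbreviation overlap :: "'i \<Rightarrow> 'i \<Rightarrow> (nat \<Rightarrow>\<^sub>0 'e) set" where
  "overlap \<alpha> \<beta> \<equiv> chart N \<alpha> ` (cdom N \<alpha> \<inter> cdom N \<beta>)"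

abbreviation transition :: "'i \<Rightarrow> 'i \<Rightarrow> (nat \<Rightarrow>\<^sub>0 'e) \<Rightarrow> (nat \<Rightarrow>\<^sub>0 'e)" where
  "transition \<alpha> \<beta> \<equiv> chart N \<beta> \<circ> chart_inv N \<alpha>"

definition transition_deriv :: "('a, 'i, nat \<Rightarrow>\<^sub>0 'e) tpoint \<Rightarrow> 'i \<Rightarrow> 'i \<Rightarrow> (nat \<Rightarrow>\<^sub>0 'e) \<Rightarrow> (nat \<Rightarrow>\<^sub>0 'e)" where
  "transition_deriv p \<alpha> \<beta> = deriv_in r (transition \<alpha> \<beta>) (chart N \<alpha> p)"

lemma open_chart_image: "\<alpha> \<in> index N \<Longrightarrow> open_in r (chart N \<alpha> ` cdom N \<alpha>)"
  using open_overlap[of \<alpha> \<alpha>] by simp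

lemma chart_inv_chart [simp]: "\<alpha> \<in> index N \<Longrightarrow> p \<in> cdom N \<alpha> \<Longrightarrow> chart_inv N \<alpha> (chart N \<alpha> p) = p"
  by (simp add: chart_inv_def inj_chart)

lemma chart_in: "\<alpha> \<in> index N \<Longrightarrow> p \<in> cdom N \<alpha> \<Longrightarrow> chart N \<alpha> p \<in> E_space r"
  using openin_imp_subset[OF open_chart_image] by blast

lemma transition_maps_space: "\<alpha> \<in> index N \<Longrightarrow> \<beta> \<in> index N \<Longrightarrow> transition \<alpha> \<beta> ` overlap \<alpha> \<beta> \<subseteq> E_space r"
  using chart_in by auto

lemma transition_has_derivative:
  assumes "\<alpha> \<in> index N" "\<beta> \<in> index N" "p \<in> cdom N \<alpha>" "p \<in> cdom N \<beta>"
  shows "(transition \<alpha> \<beta> has_derivative transition_deriv p \<alpha> \<beta>) (at (chart N \<alpha> p) within E_space r)"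
  using E_smooth_on_differentiable[OF smooth_transition[OF assms(1,2)], of "chart N \<alpha> p"] assms
  unfolding transition_deriv_def frechet_derivative_works by blast

lemma transition_deriv_in:
  assumes "\<alpha> \<in> index N" "\<beta> \<in> index N" "p \<in> cdom N \<alpha>" "p \<in> cdom N \<beta>" "v \<in> E_space r"
  shows "transition_deriv p \<alpha> \<beta> v \<in> E_space r"
  using has_derivative_in_space[OF open_overlap[OF assms(1,2)] _ transition_maps_space[OF assms(1,2)]
      transition_has_derivative[OF assms(1-4)] assms(5)] assms(3,4) by blast

lemma transition_deriv_self:
  assumes "\<alpha> \<in> index N" "p \<in> cdom N \<alpha>" "v \<in> E_space r"
  shows "transition_deriv p \<alpha> \<alpha> v = v"
proof -
  have "deriv_in r (transition \<alpha> \<alpha>) (chart N \<alpha> p) = deriv_in r (\<lambda>x. x) (chart N \<alpha> p)"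
    using assms by (intro deriv_in_cong[OF open_chart_image]) auto
  then show ?thesis
    using deriv_in_eq[OF has_derivative_ident chart_in[OF assms(1,2)] assms(3)]
    by (simp add: transition_deriv_def)
qed

text \<open>Near \<open>p\<close> the map in chart \<alpha> is the map in chart \<beta> after the
  transition, so this is the chain rule. The target of \<open>g\<close> is left general: with a
  chart for \<open>g\<close> it yields the cocycle rule for transition derivatives, with a chart
  after a map it shows tangent maps to be well defined.\<close>

lemma has_derivative_change_chart:
  assumes "\<alpha> \<in> index N" "\<beta> \<in> index N" "p \<in> cdom N \<alpha>" "p \<in> cdom N \<beta>"
    and g: "(g \<circ> chart_inv N \<beta> has_derivative g') (at (chart N \<beta> p) within E_space r)"
  shows "(g \<circ> chart_inv N \<alpha> has_derivative (\<lambda>v. g' (transition_deriv p \<alpha> \<beta> v)))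
    (at (chart N \<alpha> p) within E_space r)"
proof (rule has_derivative_cong_open_in[OF open_overlap[OF assms(1,2)]])
  show p: "chart N \<alpha> p \<in> overlap \<alpha> \<beta>"
    using assms by blast
  show "((\<lambda>x. (g \<circ> chart_inv N \<beta>) (transition \<alpha> \<beta> x)) has_derivative (\<lambda>v. g' (transition_deriv p \<alpha> \<beta> v)))
    (at (chart N \<alpha> p) within E_space r)"
    by (rule has_derivative_compose_in[OF open_overlap[OF assms(1,2)] p transition_maps_space[OF assms(1,2)]
          transition_has_derivative[OF assms(1-4)]])
       (use assms in \<open>simp add: comp_def\<close>)
qed (use assms in auto)

lemma transition_deriv_compose:
  assumes "\<alpha> \<in> index N" "\<beta> \<in> index N" "\<gamma> \<in> index N" "p \<in> cdom N \<alpha>" "p \<in> cdom N \<beta>" "p \<in> cdom N \<gamma>"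
    and "v \<in> E_space r"
  shows "transition_deriv p \<beta> \<gamma> (transition_deriv p \<alpha> \<beta> v) = transition_deriv p \<alpha> \<gamma> v"
  using deriv_in_eq[OF has_derivative_change_chart[OF assms(1,2,4,5) transition_has_derivative[OF assms(2,3,5,6)]]
      chart_in[OF assms(1,4)] assms(7)]
  by (simp add: transition_deriv_def)

lemma tangent_class_eq:
  "tangent_class N p \<alpha> v = {(\<beta>, w). \<beta> \<in> index N \<and> p \<in> cdom N \<beta> \<and> w = transition_deriv p \<alpha> \<beta> v}"
  by (simp add: tangent_class_def transition_deriv_def model_eq)

lemma tangent_class_change_chart:
  assumes "\<alpha> \<in> index N" "\<beta> \<in> index N" "p \<in> cdom N \<alpha>" "p \<in> cdom N \<beta>" "v \<in> E_space r"
  shows "tangent_class N p \<alpha> v = tangent_class N p \<beta> (transition_deriv p \<alpha> \<beta> v)"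
  using transition_deriv_compose[OF assms(1,2) _ assms(3,4) _ assms(5)] by (auto simp: tangent_class_eq)

lemma tangent_class_component:
  assumes "\<alpha> \<in> index N" "p \<in> cdom N \<alpha>" "v \<in> E_space r"
  shows "(THE w. (\<alpha>, w) \<in> tangent_class N p \<alpha> v) = v"
  using assms by (simp add: tangent_class_eq transition_deriv_self)

section \<open>Charts and transition maps of the tangent bundle\<close>

abbreviation TN :: "('a, 'i, 'e) tmfd" where "TN \<equiv> tangent_bundle r N"

lemma index_TN [simp]: "index TN = index N"
  by (simp add: tangent_bundle_def)

lemma model_TN [simp]: "model TN = E_space (Suc r)"
  by (simp add: tangent_bundle_def)

lemma cdom_TN: "cdom TN \<alpha> = {Tan p (tangent_class N p \<alpha> v) | p v. p \<in> cdom N \<alpha> \<and> v \<in> E_space r}"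
  by (simp add: tangent_bundle_def model_eq)

lemma chart_TN_Tan:
  assumes "\<alpha> \<in> index N" "p \<in> cdom N \<alpha>" "v \<in> E_space r"
  shows "chart TN \<alpha> (Tan p (tangent_class N p \<alpha> v)) = E_pair r (chart N \<alpha> p) v"
  using tangent_class_component[OF assms] by (simp add: tangent_bundle_def)

lemma Tan_in_cdom:
  assumes "\<alpha> \<in> index N" "\<beta> \<in> index N" "p \<in> cdom N \<alpha>" "p \<in> cdom N \<beta>" "v \<in> E_space r"
  shows "Tan p (tangent_class N p \<alpha> v) \<in> cdom TN \<beta>"
  using tangent_class_change_chart[OF assms] transition_deriv_in[OF assms] assms(4)
  unfolding cdom_TN by blast

lemma points_TN: "points TN = (\<Union>\<alpha>\<in>index N. cdom TN \<alpha>)"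
  unfolding cdom_TN by (auto simp: tangent_bundle_def points_eq model_eq)

lemma foot_in_cdom: "\<xi> \<in> cdom TN \<alpha> \<Longrightarrow> foot \<xi> \<in> cdom N \<alpha>"
  by (auto simp: cdom_TN)

text \<open>A tangent vector at \<open>p\<close> has a representative in every chart around
  \<open>p\<close>, so its foot alone decides.\<close>

lemma cdom_TN_iff: "\<xi> \<in> points TN \<Longrightarrow> \<beta> \<in> index N \<Longrightarrow> \<xi> \<in> cdom TN \<beta> \<longleftrightarrow> foot \<xi> \<in> cdom N \<beta>"
  using Tan_in_cdom unfolding points_TN by (fastforce simp: cdom_TN)

lemma E_fst_chart_TN:
  assumes "\<alpha> \<in> index N" "\<xi> \<in> cdom TN \<alpha>"
  shows "E_fst r (chart TN \<alpha> \<xi>) = chart N \<alpha> (foot \<xi>)"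
  using assms chart_in by (auto simp: cdom_TN chart_TN_Tan)

lemma chart_TN_image:
  assumes "\<alpha> \<in> index N" "\<beta> \<in> index N"
  shows "chart TN \<alpha> ` (cdom TN \<alpha> \<inter> cdom TN \<beta>) = tangent_set r (overlap \<alpha> \<beta>)"
proof (intro subset_antisym subsetI)
  fix z assume "z \<in> chart TN \<alpha> ` (cdom TN \<alpha> \<inter> cdom TN \<beta>)"
  then obtain p v where "p \<in> cdom N \<alpha>" "v \<in> E_space r" "z = E_pair r (chart N \<alpha> p) v" "p \<in> cdom N \<beta>"
    using assms by (auto simp: cdom_TN chart_TN_Tan)
  then show "z \<in> tangent_set r (overlap \<alpha> \<beta>)"
    using assms chart_in by (auto simp: tangent_set_def)
next
  fix z assume z: "z \<in> tangent_set r (overlap \<alpha> \<beta>)"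
  then obtain p where p: "p \<in> cdom N \<alpha>" "p \<in> cdom N \<beta>" "E_fst r z = chart N \<alpha> p"
    by (auto simp: tangent_set_def)
  let ?\<xi> = "Tan p (tangent_class N p \<alpha> (E_snd r z))"
  have "chart TN \<alpha> ?\<xi> = E_pair r (E_fst r z) (E_snd r z)"
    using p assms by (simp add: chart_TN_Tan)
  then have "z = chart TN \<alpha> ?\<xi>"
    using z by (simp add: tangent_set_def)
  moreover have "?\<xi> \<in> cdom TN \<alpha> \<inter> cdom TN \<beta>"
    using p assms Tan_in_cdom by simp
  ultimately show "z \<in> chart TN \<alpha> ` (cdom TN \<alpha> \<inter> cdom TN \<beta>)"
    by blast
qed

lemma inj_on_chart_TN: 
  assumes "\<alpha> \<in> index N"
  shows "inj_on (chart TN \<alpha>) (cdom TN \<alpha>)"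
proof (rule inj_onI)
  fix \<xi> \<eta> assume "\<xi> \<in> cdom TN \<alpha>" "\<eta> \<in> cdom TN \<alpha>" and eq: "chart TN \<alpha> \<xi> = chart TN \<alpha> \<eta>"
  then obtain p v q w where *: "\<xi> = Tan p (tangent_class N p \<alpha> v)" "\<eta> = Tan q (tangent_class N q \<alpha> w)"
    "p \<in> cdom N \<alpha>" "q \<in> cdom N \<alpha>" "v \<in> E_space r" "w \<in> E_space r"
    by (auto simp: cdom_TN)
  then have "chart N \<alpha> p = chart N \<alpha> q \<and> v = w"
    using eq assms chart_in by (simp add: chart_TN_Tan E_pair_eq_iff)
  then show "\<xi> = \<eta>"
    using * inj_chart[OF assms] by (auto dest: inj_onD)
qed

lemma transition_TN:
  assumes \<alpha>: "\<alpha> \<in> index N" and \<beta>: "\<beta> \<in> index N" and z: "z \<in> tangent_set r (overlap \<alpha> \<beta>)"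
  shows "(chart TN \<beta> \<circ> chart_inv TN \<alpha>) z = E_tangent r r (transition \<alpha> \<beta>) z"
proof -
  obtain \<xi> where \<xi>: "\<xi> \<in> cdom TN \<alpha>" "\<xi> \<in> cdom TN \<beta>" "z = chart TN \<alpha> \<xi>"
    using z chart_TN_image[OF \<alpha> \<beta>] by blast
  then obtain p v where p: "\<xi> = Tan p (tangent_class N p \<alpha> v)" "p \<in> cdom N \<alpha>" "v \<in> E_space r" "p \<in> cdom N \<beta>"
    by (auto simp: cdom_TN)
  have "(chart TN \<beta> \<circ> chart_inv TN \<alpha>) z = chart TN \<beta> \<xi>"
    using \<xi> inj_on_chart_TN[OF \<alpha>] by (simp add: chart_inv_def)
  also have "\<dots> = E_pair r (chart N \<beta> p) (transition_deriv p \<alpha> \<beta> v)"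
    using p \<alpha> \<beta> tangent_class_change_chart[OF \<alpha> \<beta> p(2,4,3)] transition_deriv_in[OF \<alpha> \<beta> p(2,4,3)]
    by (simp add: chart_TN_Tan)
  also have "\<dots> = E_tangent r r (transition \<alpha> \<beta>) (E_pair r (chart N \<alpha> p) v)"
    using p \<alpha> chart_in[OF \<alpha> p(2)] by (simp add: E_tangent_pair transition_deriv_def)
  also have "E_pair r (chart N \<alpha> p) v = z"
    using \<xi> p \<alpha> by (simp add: chart_TN_Tan)
  finally show ?thesis .
qed

lemma E_manifold_TN: "E_manifold (Suc r) TN"
proof unfold_locales
  show "E_smooth_on (Suc r) (Suc r) (chart TN \<alpha> ` (cdom TN \<alpha> \<inter> cdom TN \<beta>)) (chart TN \<beta> \<circ> chart_inv TN \<alpha>)"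
    if "\<alpha> \<in> index TN" "\<beta> \<in> index TN" for \<alpha> \<beta>
  proof (rule E_smooth_on_cong)
    show "E_smooth_on (Suc r) (Suc r) (chart TN \<alpha> ` (cdom TN \<alpha> \<inter> cdom TN \<beta>)) (E_tangent r r (transition \<alpha> \<beta>))"
      using that E_smooth_on_tangent[OF smooth_transition[of \<alpha> \<beta>]] by (simp add: chart_TN_image)
  qed (use that in \<open>simp_all add: chart_TN_image open_in_tangent_set open_overlap transition_TN del: comp_apply\<close>)
qed (auto simp: points_TN inj_on_chart_TN chart_TN_image open_in_tangent_set open_overlap)

end

section \<open>Maps with a representative in every chart\<close>

text \<open>
  All maps between iterated tangent bundles considered here cover the identity of \<open>M\<close>, so a
  single chart \<open>\<alpha>\<close> of \<open>M\<close> serves for both source and target.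
\<close>

definition represents ::
  "('a, 'i, 'e::real_normed_vector) tmfd \<Rightarrow> ('a, 'i, 'e) tmfd
    \<Rightarrow> (('a, 'i, nat \<Rightarrow>\<^sub>0 'e) tpoint \<Rightarrow> ('a, 'i, nat \<Rightarrow>\<^sub>0 'e) tpoint)
    \<Rightarrow> ('i \<Rightarrow> (nat \<Rightarrow>\<^sub>0 'e) \<Rightarrow> (nat \<Rightarrow>\<^sub>0 'e)) \<Rightarrow> bool" where
  "represents N P f F \<longleftrightarrow>
     (\<forall>\<alpha>\<in>index N. \<forall>\<xi>\<in>cdom N \<alpha>. f \<xi> \<in> cdom P \<alpha> \<and> chart P \<alpha> (f \<xi>) = F \<alpha> (chart N \<alpha> \<xi>))"

lemma representsD:
  assumes "represents N P f F" "\<alpha> \<in> index N" "\<xi> \<in> cdom N \<alpha>"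
  shows "f \<xi> \<in> cdom P \<alpha>" "chart P \<alpha> (f \<xi>) = F \<alpha> (chart N \<alpha> \<xi>)"
  using assms unfolding represents_def by blast+

lemma represents_compose:
  "represents N P f F \<Longrightarrow> represents P Q g G \<Longrightarrow> index N = index P
    \<Longrightarrow> represents N Q (g \<circ> f) (\<lambda>\<alpha>. G \<alpha> \<circ> F \<alpha>)"
  by (auto simp: represents_def)

lemma represents_cong:
  assumes "represents N P f F" "\<And>\<alpha> x. \<alpha> \<in> index N \<Longrightarrow> x \<in> chart N \<alpha> ` cdom N \<alpha> \<Longrightarrow> F \<alpha> x = G \<alpha> x"
  shows "represents N P f G"
  using assms unfolding represents_def by auto

lemma represents_maps:
  assumes "represents N P f F" "\<alpha> \<in> index N"
  shows "F \<alpha> ` chart N \<alpha> ` cdom N \<alpha> \<subseteq> chart P \<alpha> ` cdom P \<alpha>"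
  using representsD[OF assms] by (force simp: image_subset_iff)

text \<open>\<open>tangent_map\<close> collects the images of all representatives of a class,
  computed in all charts at the point. The work lies in showing that they agree and form the class
  of one vector, the derivative of \<open>F \<alpha>\<close> applied to \<open>v\<close>.\<close>

lemma represents_tmap:
  assumes N: "E_manifold r N" and P: "E_manifold s P" and ind: "index N = index P"
    and f: "represents N P f F"
    and F: "\<And>\<alpha> x. \<alpha> \<in> index N \<Longrightarrow> x \<in> chart N \<alpha> ` cdom N \<alpha> \<Longrightarrow> F \<alpha> differentiable (at x within E_space r)"
  shows "represents (tangent_bundle r N) (tangent_bundle s P) (tmap N P f) (\<lambda>\<alpha>. E_tangent r s (F \<alpha>))"
  unfolding represents_def
proof (intro ballI)
  interpret N: E_manifold r N by (rule N)
  interpret P: E_manifold s P by (rule P)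
  fix \<alpha> \<xi> assume "\<alpha> \<in> index N.TN" and \<xi>: "\<xi> \<in> cdom N.TN \<alpha>"
  then have \<alpha>: "\<alpha> \<in> index N" "\<alpha> \<in> index P"
    using ind by auto
  obtain p v where p: "\<xi> = Tan p (tangent_class N p \<alpha> v)" "p \<in> cdom N \<alpha>" "v \<in> E_space r"
    using \<xi> by (auto simp: N.cdom_TN)
  note fp = representsD[OF f \<alpha>(1) p(2)]
  define w where "w = deriv_in r (F \<alpha>) (chart N \<alpha> p) v"
  have maps: "F \<alpha> ` chart N \<alpha> ` cdom N \<alpha> \<subseteq> E_space s"
    using represents_maps[OF f \<alpha>(1)] openin_imp_subset[OF P.open_chart_image[OF \<alpha>(2)]] by blast
  have Fd: "(F \<alpha> has_derivative deriv_in r (F \<alpha>) (chart N \<alpha> p)) (at (chart N \<alpha> p) within E_space r)"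
    if "\<alpha> \<in> index N" "p \<in> cdom N \<alpha>" for \<alpha>
    using F[OF that(1), of "chart N \<alpha> p"] that by (simp add: frechet_derivative_works)
  have ws: "w \<in> E_space s"
    unfolding w_def
    by (rule has_derivative_in_space[OF N.open_chart_image[OF \<alpha>(1)] _ maps Fd[OF \<alpha>(1) p(2)] p(3)]) (use p in simp)
  \<comment> \<open>With different charts \<gamma> and \<beta> on source and target, the local form
    of \<open>f\<close> is the transition from \<gamma> to \<beta> after
    \<open>F \<gamma>\<close>.\<close>
  have local_rep: "((chart P \<beta> \<circ> f) \<circ> chart_inv N \<gamma> has_derivative
      (\<lambda>v. P.transition_deriv (f p) \<gamma> \<beta> (deriv_in r (F \<gamma>) (chart N \<gamma> p) v)))
      (at (chart N \<gamma> p) within E_space r)"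
    if \<gamma>: "\<gamma> \<in> index N" "p \<in> cdom N \<gamma>" and \<beta>: "\<beta> \<in> index P" "f p \<in> cdom P \<beta>" for \<beta> \<gamma>
  proof (rule has_derivative_cong_open_in[OF N.open_chart_image[OF \<gamma>(1)]])
    have \<gamma>P: "\<gamma> \<in> index P"
      using \<gamma> ind by simp
    show "chart N \<gamma> p \<in> chart N \<gamma> ` cdom N \<gamma>"
      using \<gamma> by simp
    then show "((\<lambda>x. P.transition \<gamma> \<beta> (F \<gamma> x)) has_derivative
        (\<lambda>v. P.transition_deriv (f p) \<gamma> \<beta> (deriv_in r (F \<gamma>) (chart N \<gamma> p) v)))
        (at (chart N \<gamma> p) within E_space r)"
      using represents_maps[OF f \<gamma>(1)] openin_imp_subset[OF P.open_chart_image[OF \<gamma>P]]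
        P.transition_has_derivative[OF \<gamma>P \<beta>(1) representsD(1)[OF f \<gamma>] \<beta>(2)] representsD[OF f \<gamma>]
      by (intro has_derivative_compose_in[OF N.open_chart_image[OF \<gamma>(1)] _ _ Fd[OF \<gamma>]]) (blast, blast, simp add: comp_def)
    \<comment> \<open>This holds on the whole image of chart \<gamma>, also where \<open>f q\<close>
      leaves \<open>cdom P \<beta>\<close>: it needs only \<open>f q \<in> cdom P \<gamma>\<close>,
      and charts are total functions.\<close>
    show "P.transition \<gamma> \<beta> (F \<gamma> y) = ((chart P \<beta> \<circ> f) \<circ> chart_inv N \<gamma>) y"
      if "y \<in> chart N \<gamma> ` cdom N \<gamma>" for y
    proof -
      obtain q where q: "q \<in> cdom N \<gamma>" "y = chart N \<gamma> q"
        using \<open>y \<in> chart N \<gamma> ` cdom N \<gamma>\<close> by blast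
      show ?thesis
        using representsD[OF f \<gamma>(1) q(1)] \<gamma> \<gamma>P q by (simp flip: representsD(2)[OF f \<gamma>(1) q(1)])
    qed
  qed
  \<comment> \<open>The local forms through \<gamma> and through \<alpha> come from the same map
    into chart \<beta>, so \<open>N.has_derivative_change_chart\<close> makes the result independent
    of \<gamma>.\<close>
  have key: "deriv_in r (chart P \<beta> \<circ> f \<circ> chart_inv N \<gamma>) (chart N \<gamma> p) (N.transition_deriv p \<alpha> \<gamma> v)
      = P.transition_deriv (f p) \<alpha> \<beta> w"
    if \<gamma>: "\<gamma> \<in> index N" "p \<in> cdom N \<gamma>" and \<beta>: "\<beta> \<in> index P" "f p \<in> cdom P \<beta>" for \<beta> \<gamma>
  proof -
    note u = N.transition_deriv_in[OF \<alpha>(1) \<gamma>(1) p(2) \<gamma>(2) p(3)]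
    have "deriv_in r (chart P \<beta> \<circ> f \<circ> chart_inv N \<gamma>) (chart N \<gamma> p) (N.transition_deriv p \<alpha> \<gamma> v)
      = P.transition_deriv (f p) \<gamma> \<beta> (deriv_in r (F \<gamma>) (chart N \<gamma> p) (N.transition_deriv p \<alpha> \<gamma> v))"
      by (rule deriv_in_eq[OF local_rep[OF \<gamma> \<beta>] N.chart_in[OF \<gamma>] u])
    also have "\<dots> = deriv_in r (chart P \<beta> \<circ> f \<circ> chart_inv N \<alpha>) (chart N \<alpha> p) v"
      by (rule deriv_in_eq[OF N.has_derivative_change_chart[OF \<alpha>(1) \<gamma>(1) p(2) \<gamma>(2) local_rep[OF \<gamma> \<beta>]]
            N.chart_in[OF \<alpha>(1) p(2)] p(3), symmetric])
    also have "\<dots> = P.transition_deriv (f p) \<alpha> \<beta> w"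
      unfolding w_def by (rule deriv_in_eq[OF local_rep[OF \<alpha>(1) p(2) \<beta>] N.chart_in[OF \<alpha>(1) p(2)] p(3)])
    finally show ?thesis .
  qed
  have "tangent_map N P f p (tangent_class N p \<alpha> v) = tangent_class P (f p) \<alpha> w"
    unfolding tangent_map_def P.tangent_class_eq N.tangent_class_eq N.model_eq
    using key p(2) \<alpha>(1) by fastforce
  then have "tmap N P f \<xi> = Tan (f p) (tangent_class P (f p) \<alpha> w)"
    by (simp add: tmap_def p(1))
  then show "tmap N P f \<xi> \<in> cdom P.TN \<alpha> \<and>
      chart P.TN \<alpha> (tmap N P f \<xi>) = E_tangent r s (F \<alpha>) (chart N.TN \<alpha> \<xi>)"
    using P.Tan_in_cdom[OF \<alpha>(2,2) fp(1,1) ws] \<alpha> fp ws p N.chart_in[OF \<alpha>(1) p(2)]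
    by (simp add: P.chart_TN_Tan N.chart_TN_Tan E_tangent_pair w_def)
qed

lemma represents_tmap_linear:
  assumes "E_manifold r N" "E_manifold s P" "index N = index P" "represents N P f (\<lambda>_. L)" "bounded_linear L"
  shows "represents (tangent_bundle r N) (tangent_bundle s P) (tmap N P f) (\<lambda>_. lin_tangent r s L)"
  using represents_cong[OF represents_tmap[OF assms(1-4)]] assms(5)
  by (simp add: bounded_linear_differentiable E_tangent_linear)

lemma represents_foot:
  assumes "E_manifold r N"
  shows "represents (tangent_bundle r N) N foot (\<lambda>_. E_fst r)"
proof -
  interpret E_manifold r N by (rule assms)
  show ?thesis
    using foot_in_cdom E_fst_chart_TN by (simp add: represents_def)
qed

section \<open>The iterated tangent bundles\<close>

lemma E_space_0: "E_space 0 = range (Poly_Mapping.single 0)"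
proof (intro subset_antisym subsetI)
  fix x :: "nat \<Rightarrow>\<^sub>0 'a" assume "x \<in> E_space 0"
  then have "x = Poly_Mapping.single 0 (Poly_Mapping.lookup x 0)"
    by (intro poly_mapping_eqI) (auto simp: E_space_def lookup_single when_def)
  then show "x \<in> range (Poly_Mapping.single 0)"
    by blast
qed (auto simp: E_space_def lookup_single when_def)

lemma open_in_single_image:
  assumes "open U"
  shows "open_in 0 (Poly_Mapping.single 0 ` U)"
proof -
  have "open ((\<lambda>x. Poly_Mapping.lookup x 0) -` U :: (nat \<Rightarrow>\<^sub>0 'a) set)"
    by (intro open_vimage assms linear_continuous_on bounded_linear_lookup)
  moreover have "Poly_Mapping.single 0 ` U = E_space 0 \<inter> (\<lambda>x. Poly_Mapping.lookup x 0) -` U"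
    unfolding E_space_0 by auto
  ultimately show ?thesis
    by (metis openin_open_Int)
qed

text \<open>\<open>Poly_Mapping.single 0\<close> identifies \<open>'e\<close> with E_0 linearly and
  isometrically, and \<open>smooth_on\<close> is defined by transport along it, so the atlas of M
  carries over.\<close>

lemma E_manifold_T_zero:
  fixes M :: "('a, 'c, 'b::banach) mfd"
  assumes M: "banach_manifold M"
  shows "E_manifold 0 (T_zero M)"
proof
  let ?s = "\<lambda>x. Poly_Mapping.single (0::nat) x"
  have inj: "inj_on (chart M \<alpha>) (cdom M \<alpha>)" if "\<alpha> \<in> index M" for \<alpha>
    using M that by (simp add: banach_manifold_def)
  have s: "?s x = ?s y \<longleftrightarrow> x = y" for x y
    by (metis lookup_single_eq)
  show inj0: "inj_on (chart (T_zero M) \<alpha>) (cdom (T_zero M) \<alpha>)" if "\<alpha> \<in> index (T_zero M)" for \<alpha>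
    using inj[of \<alpha>] that by (auto simp: T_zero_def inj_on_def s)
  have img: "chart (T_zero M) \<alpha> ` (cdom (T_zero M) \<alpha> \<inter> cdom (T_zero M) \<beta>) = ?s ` chart M \<alpha> ` (cdom M \<alpha> \<inter> cdom M \<beta>)"
    for \<alpha> \<beta>
  proof -
    have "(Pt ` cdom M \<alpha> \<inter> Pt ` cdom M \<beta> :: ('a, 'c, nat \<Rightarrow>\<^sub>0 'b) tpoint set) = Pt ` (cdom M \<alpha> \<inter> cdom M \<beta>)"
      by auto
    then show ?thesis
      by (simp add: T_zero_def image_image)
  qed
  fix \<alpha> \<beta> assume \<alpha>0: "\<alpha> \<in> index (T_zero M)" and "\<beta> \<in> index (T_zero M)"
  then have \<alpha>: "\<alpha> \<in> index M" and \<beta>: "\<beta> \<in> index M"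
    by (auto simp: T_zero_def)
  show op: "open_in 0 (chart (T_zero M) \<alpha> ` (cdom (T_zero M) \<alpha> \<inter> cdom (T_zero M) \<beta>))"
    unfolding img using M \<alpha> \<beta> by (intro open_in_single_image) (simp add: banach_manifold_def)
  have sm: "E_smooth_on 0 0 (chart (T_zero M) \<alpha> ` (cdom (T_zero M) \<alpha> \<inter> cdom (T_zero M) \<beta>))
      (\<lambda>x. ?s ((chart M \<beta> \<circ> chart_inv M \<alpha>) (Poly_Mapping.lookup x 0)))"
    unfolding img using M \<alpha> \<beta> by (simp add: banach_manifold_def smooth_on_def)
  show "E_smooth_on 0 0 (chart (T_zero M) \<alpha> ` (cdom (T_zero M) \<alpha> \<inter> cdom (T_zero M) \<beta>))
      (chart (T_zero M) \<beta> \<circ> chart_inv (T_zero M) \<alpha>)"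
  proof (rule E_smooth_on_cong[OF op _ sm])
    fix x assume "x \<in> chart (T_zero M) \<alpha> ` (cdom (T_zero M) \<alpha> \<inter> cdom (T_zero M) \<beta>)"
    then obtain p where p: "p \<in> cdom M \<alpha>" "x = ?s (chart M \<alpha> p)"
      unfolding img by blast
    then have "x = chart (T_zero M) \<alpha> (Pt p)" "Pt p \<in> cdom (T_zero M) \<alpha>"
      by (auto simp: T_zero_def)
    then have "chart_inv (T_zero M) \<alpha> x = Pt p"
      using inv_into_f_f[OF inj0[OF \<alpha>0]] by (simp add: chart_inv_def)
    moreover have "chart_inv M \<alpha> (Poly_Mapping.lookup x 0) = p"
      using p inj[OF \<alpha>] by (simp add: chart_inv_def)
    ultimately show "?s ((chart M \<beta> \<circ> chart_inv M \<alpha>) (Poly_Mapping.lookup x 0))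
      = (chart (T_zero M) \<beta> \<circ> chart_inv (T_zero M) \<alpha>) x"
      by (simp add: T_zero_def)
  qed
qed (use M in \<open>auto simp: T_zero_def banach_manifold_def\<close>)

declare TB.simps [simp del]

locale iterated_tangent_bundles =
  fixes M :: "('a, 'i, 'e::banach) mfd"
  assumes banach_manifold: "banach_manifold M"
begin

lemma E_manifold_TB: "E_manifold r (TB M r)"
  by (induction r) (simp_all add: TB.simps E_manifold_T_zero banach_manifold E_manifold.E_manifold_TN)

sublocale TB: E_manifold r "TB M r" for r
  by (rule E_manifold_TB)

lemma index_TB [simp]: "index (TB M r) = index M"
  by (induction r) (simp_all add: TB.simps T_zero_def tangent_bundle_def)

text \<open>Each tangent step adds an unrestricted vector component, so only coordinate 0, the
  component over M, stays constrained. Linear maps that keep this coordinate therefore respect the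
  chart images at all levels.\<close>

lemma chart_TB_image:
  assumes "\<alpha> \<in> index M"
  shows "chart (TB M r) \<alpha> ` cdom (TB M r) \<alpha>
    = {z \<in> E_space r. Poly_Mapping.lookup z 0 \<in> chart M \<alpha> ` cdom M \<alpha>}"
proof (induction r)
  case 0
  have "Poly_Mapping.single 0 ` A = {z \<in> E_space 0. Poly_Mapping.lookup z 0 \<in> A}" for A :: "'e set"
    unfolding E_space_0 by auto
  moreover have "chart (T_zero M) \<alpha> ` cdom (T_zero M) \<alpha> = Poly_Mapping.single 0 ` chart M \<alpha> ` cdom M \<alpha>"
    by (simp add: T_zero_def image_image)
  ultimately show ?case
    by (simp add: TB.simps)
next
  case (Suc r)
  then show ?case
    using TB.chart_TN_image[of \<alpha> r \<alpha>] assms by (simp add: TB.simps tangent_set_def lookup_E_fst)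
qed

section \<open>Projections, connecting maps and involutions in charts\<close>

abbreviation reps where "reps r s \<equiv> represents (TB M r) (TB M s)"

lemma reps_foot: "reps (Suc r) r foot (\<lambda>_. E_fst r)"
  using represents_foot[OF E_manifold_TB] by (simp add: TB.simps)

lemma reps_tmap_linear:
  "reps r s f (\<lambda>_. L) \<Longrightarrow> bounded_linear L \<Longrightarrow> reps (Suc r) (Suc s) (tmap (TB M r) (TB M s) f) (\<lambda>_. lin_tangent r s L)"
  using represents_tmap_linear[OF E_manifold_TB E_manifold_TB] by (simp add: TB.simps)

lemma reps_conn: "reps (i + 1 + j) (i + j) (conn M j i) (\<lambda>_. E_conn j i)"
proof (induction j)
  case 0
  show ?case
    using reps_foot[of i] by (simp add: E_conn_0 del: E_conn.simps)
next
  case (Suc j)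
  show ?case
    using reps_tmap_linear[OF Suc bounded_linear_E_conn] by (simp add: E_conn_Suc del: E_conn.simps)
qed

lemma E_flip_overlap:
  assumes "\<alpha> \<in> index M" "\<beta> \<in> index M" "z \<in> TB.overlap (Suc (Suc r)) \<alpha> \<beta>"
  shows "E_flip r z \<in> TB.overlap (Suc (Suc r)) \<alpha> \<beta>"
proof -
  have *: "TB.overlap (Suc (Suc r)) \<alpha> \<beta> = tangent_set (Suc r) (tangent_set r (TB.overlap r \<alpha> \<beta>))"
    using TB.chart_TN_image[of \<alpha> r \<beta>] TB.chart_TN_image[of \<alpha> "Suc r" \<beta>] assms by (simp add: TB.simps)
  have "z \<in> E_space (Suc (Suc r))"
    using assms unfolding * by (simp add: tangent_set_def)
  then show ?thesis
    using assms(3) unfolding * by (auto elim!: E_space_Suc_Suc_cases simp: tangent_set_def E_flip_pair)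
qed

text \<open>The transition maps of T^(r+2)M are second tangent maps of those of T^rM, so this is the
  symmetry of second derivatives. It makes the chart formula of the involution independent of the
  chart.\<close>

lemma transition_E_flip:
  assumes \<alpha>: "\<alpha> \<in> index M" and \<beta>: "\<beta> \<in> index M" and z: "z \<in> TB.overlap (Suc (Suc r)) \<alpha> \<beta>"
  shows "TB.transition (Suc (Suc r)) \<alpha> \<beta> (E_flip r z) = E_flip r (TB.transition (Suc (Suc r)) \<alpha> \<beta> z)"
proof -
  let ?W = "TB.overlap r \<alpha> \<beta>" and ?t = "TB.transition r \<alpha> \<beta>"
  have W: "open_in r ?W"
    using \<alpha> \<beta> TB.open_overlap by simp
  have ov: "TB.overlap (Suc r) \<alpha> \<beta> = tangent_set r ?W"
    using TB.chart_TN_image[of \<alpha> r \<beta>] \<alpha> \<beta> by (simp add: TB.simps)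
  have ov2: "TB.overlap (Suc (Suc r)) \<alpha> \<beta> = tangent_set (Suc r) (tangent_set r ?W)"
    using TB.chart_TN_image[of \<alpha> "Suc r" \<beta>] ov \<alpha> \<beta> by (simp add: TB.simps)
  have eq: "TB.transition (Suc (Suc r)) \<alpha> \<beta> z = E_tangent (Suc r) (Suc r) (E_tangent r r ?t) z"
    if z: "z \<in> TB.overlap (Suc (Suc r)) \<alpha> \<beta>" for z
  proof -
    have "TB.transition (Suc (Suc r)) \<alpha> \<beta> z = E_tangent (Suc r) (Suc r) (TB.transition (Suc r) \<alpha> \<beta>) z"
      using TB.transition_TN[of \<alpha> "Suc r" \<beta> z] \<alpha> \<beta> z unfolding ov2 ov by (simp add: TB.simps)
    also have "\<dots> = E_tangent (Suc r) (Suc r) (E_tangent r r ?t) z"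
      using TB.transition_TN[of \<alpha> r \<beta>] \<alpha> \<beta> z unfolding ov2
      by (intro E_tangent_cong[OF open_in_tangent_set[OF W]]) (auto simp: TB.simps simp del: comp_apply)
    finally show ?thesis .
  qed
  show ?thesis
    unfolding eq[OF z] eq[OF E_flip_overlap[OF assms]]
    using \<alpha> \<beta> z W TB.smooth_transition[of \<alpha> r \<beta>] TB.transition_maps_space[of \<alpha> r \<beta>] unfolding ov2
    by (intro E_tangent_tangent_E_flip) simp_all
qed

text \<open>\<open>kappa\<close> asks for one point that satisfies the flip formula in all charts at
  once. The point is found in a single chart \<alpha>, \<open>transition_E_flip\<close> carries the
  formula to the others, and injectivity of the chart gives uniqueness.\<close>

lemma reps_kappa: "reps (Suc (Suc r)) (Suc (Suc r)) (kappa M (Suc (Suc r))) (\<lambda>_. E_flip r)"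
  unfolding represents_def
proof (intro ballI)
  let ?N = "TB M (Suc (Suc r))"
  fix \<alpha> \<xi> assume "\<alpha> \<in> index ?N" and \<xi>: "\<xi> \<in> cdom ?N \<alpha>"
  then have \<alpha>: "\<alpha> \<in> index M"
    by simp
  then have inj: "inj_on (chart ?N \<alpha>) (cdom ?N \<alpha>)"
    by (intro TB.inj_chart) simp
  have "E_flip r (chart ?N \<alpha> \<xi>) \<in> TB.overlap (Suc (Suc r)) \<alpha> \<alpha>"
    using \<xi> by (intro E_flip_overlap[OF \<alpha> \<alpha>]) simp
  then obtain \<eta> where \<eta>: "\<eta> \<in> cdom ?N \<alpha>" "chart ?N \<alpha> \<eta> = E_flip r (chart ?N \<alpha> \<xi>)"
    by auto
  have \<eta>\<beta>: "\<eta> \<in> cdom ?N \<beta> \<and> chart ?N \<beta> \<eta> = E_flip r (chart ?N \<beta> \<xi>)" if \<beta>: "\<beta> \<in> index M" "\<xi> \<in> cdom ?N \<beta>" for \<beta>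
  proof
    have ov: "chart ?N \<alpha> \<xi> \<in> TB.overlap (Suc (Suc r)) \<alpha> \<beta>"
      using \<xi> \<beta> by blast
    have "chart ?N \<alpha> \<eta> \<in> TB.overlap (Suc (Suc r)) \<alpha> \<beta>"
      unfolding \<eta>(2) by (rule E_flip_overlap[OF \<alpha> \<beta>(1) ov])
    then obtain \<zeta> where \<zeta>: "\<zeta> \<in> cdom ?N \<alpha>" "\<zeta> \<in> cdom ?N \<beta>" "chart ?N \<alpha> \<eta> = chart ?N \<alpha> \<zeta>"
      by blast
    have "\<eta> = \<zeta>"
      by (rule inj_onD[OF inj \<zeta>(3) \<eta>(1) \<zeta>(1)])
    with \<zeta> show "\<eta> \<in> cdom ?N \<beta>"
      by simp
    have "chart ?N \<beta> \<eta> = TB.transition (Suc (Suc r)) \<alpha> \<beta> (chart ?N \<alpha> \<eta>)"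
      using \<eta>(1) \<alpha> TB.chart_inv_chart[of \<alpha> "Suc (Suc r)" \<eta>] by simp
    also have "\<dots> = E_flip r (TB.transition (Suc (Suc r)) \<alpha> \<beta> (chart ?N \<alpha> \<xi>))"
      unfolding \<eta>(2) by (rule transition_E_flip[OF \<alpha> \<beta>(1) ov])
    also have "\<dots> = E_flip r (chart ?N \<beta> \<xi>)"
      using \<xi> \<alpha> TB.chart_inv_chart[of \<alpha> "Suc (Suc r)" \<xi>] by simp
    finally show "chart ?N \<beta> \<eta> = E_flip r (chart ?N \<beta> \<xi>)" .
  qed
  have "kappa M (Suc (Suc r)) \<xi> = \<eta>"
    unfolding kappa.simps
  proof (rule the_equality)
    show "\<eta> \<in> points ?N \<and> (\<forall>\<beta>\<in>index M. \<xi> \<in> cdom ?N \<beta> \<longrightarrow>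
        \<eta> \<in> cdom ?N \<beta> \<and> chart ?N \<beta> \<eta> = E_flip r (chart ?N \<beta> \<xi>))"
      using \<eta>\<beta> \<eta>(1) \<alpha> TB.points_eq[of "Suc (Suc r)"] by auto
    fix \<zeta> assume "\<zeta> \<in> points ?N \<and> (\<forall>\<beta>\<in>index M. \<xi> \<in> cdom ?N \<beta> \<longrightarrow>
        \<zeta> \<in> cdom ?N \<beta> \<and> chart ?N \<beta> \<zeta> = E_flip r (chart ?N \<beta> \<xi>))"
    then have "\<zeta> \<in> cdom ?N \<alpha>" "chart ?N \<alpha> \<zeta> = chart ?N \<alpha> \<eta>"
      using \<xi> \<alpha> \<eta> by auto
    then show "\<zeta> = \<eta>"
      using inj_onD[OF inj _ _ \<eta>(1)] by blast
  qed
  then show "kappa M (Suc (Suc r)) \<xi> \<in> cdom ?N \<alpha> \<and>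
      chart ?N \<alpha> (kappa M (Suc (Suc r)) \<xi>) = E_flip r (chart ?N \<alpha> \<xi>)"
    using \<eta> by simp
qed

end

section \<open>The complete lift in a chart\<close>

text \<open>The chart form of T\<kappa> \<circ> \<kappa> \<circ> TA \<circ> \<kappa> for a field
  \<open>A\<close> on T^(j+1)M. The offsets come from the involution of T^(j+2)M being
  \<open>E_flip j\<close>.\<close>

definition lift_rep ::
  "nat \<Rightarrow> ((nat \<Rightarrow>\<^sub>0 'e::real_normed_vector) \<Rightarrow> (nat \<Rightarrow>\<^sub>0 'e)) \<Rightarrow> (nat \<Rightarrow>\<^sub>0 'e) \<Rightarrow> (nat \<Rightarrow>\<^sub>0 'e)" where
  "lift_rep j A z = lin_tangent (j + 2) (j + 2) (E_flip j)
     (E_flip (Suc j) (E_tangent (Suc j) (Suc (Suc j)) A (E_flip j z)))"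

text \<open>
  The last condition, that the tangent map of \<open>(x, y) \<mapsto> x\<close> takes \<open>A z\<close> back to \<open>z\<close>, is the
  form of the semispray condition which involves no involution.
\<close>

definition semispray_rep ::
  "nat \<Rightarrow> (nat \<Rightarrow>\<^sub>0 'e::real_normed_vector) set \<Rightarrow> ((nat \<Rightarrow>\<^sub>0 'e) \<Rightarrow> (nat \<Rightarrow>\<^sub>0 'e)) \<Rightarrow> bool" where
  "semispray_rep j W A \<longleftrightarrow>
     E_smooth_on (Suc j) (Suc (Suc j)) W A \<and> A ` W \<subseteq> E_space (Suc (Suc j)) \<and>
     (\<forall>z\<in>W. E_fst (Suc j) (A z) = z) \<and> (\<forall>z\<in>W. lin_tangent (Suc j) j (E_fst j) (A z) = z)"

context
  fixes j :: nat and W :: "(nat \<Rightarrow>\<^sub>0 'e::real_normed_vector) set" and A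
  assumes W: "open_in (Suc j) W" and A: "semispray_rep j W A"
begin

lemma semispray_rep_smooth: "E_smooth_on (Suc j) (Suc (Suc j)) W A"
  and semispray_rep_maps: "A ` W \<subseteq> E_space (Suc (Suc j))"
  and semispray_rep_section: "\<And>z. z \<in> W \<Longrightarrow> E_fst (Suc j) (A z) = z"
  and semispray_rep_lin_tangent: "\<And>z. z \<in> W \<Longrightarrow> lin_tangent (Suc j) j (E_fst j) (A z) = z"
  using A by (auto simp: semispray_rep_def)

lemma semispray_rep_differentiable: "z \<in> W \<Longrightarrow> A differentiable (at z within E_space (Suc j))"
  by (rule E_smooth_on_differentiable[OF semispray_rep_smooth])

context
  fixes z assumes z: "z \<in> E_space (Suc (Suc j))" "E_flip j z \<in> tangent_set (Suc j) W"
begin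

text \<open>p T\<kappa> \<kappa> TA \<kappa> = \<kappa> p \<kappa> TA \<kappa> = \<kappa> Tp TA
  \<kappa> = \<kappa> \<kappa> = id.\<close>

lemma lift_rep_section: "E_fst (Suc (Suc j)) (lift_rep j A z) = z"
proof -
  let ?B = "E_tangent (Suc j) (Suc (Suc j)) A (E_flip j z)"
  have "E_fst (Suc (Suc j)) (lift_rep j A z) = E_flip j (E_fst (Suc (Suc j)) (E_flip (Suc j) ?B))"
    by (simp add: lift_rep_def E_fst_lin_tangent)
  also have "\<dots> = E_flip j (lin_tangent (Suc (Suc j)) (Suc j) (E_fst (Suc j)) ?B)"
    by (simp add: E_fst_E_flip)
  also have "lin_tangent (Suc (Suc j)) (Suc j) (E_fst (Suc j)) ?B = E_flip j z"
    by (rule E_tangent_linear_section[OF W semispray_rep_maps bounded_linear_E_fst semispray_rep_differentiable semispray_rep_section z(2)])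
  finally show ?thesis
    using z(1) by (simp add: E_flip_flip)
qed

text \<open>Tp T\<kappa> \<kappa> TA \<kappa> = TTp \<kappa> TA \<kappa> = \<kappa> TTp TA \<kappa>
  = \<kappa> T(Tp A) \<kappa> = \<kappa> \<kappa> = id.\<close>

lemma lift_rep_semispray: "lin_tangent (Suc (Suc j)) (Suc j) (E_fst (Suc j)) (lift_rep j A z) = z"
proof -
  let ?B = "E_tangent (Suc j) (Suc (Suc j)) A (E_flip j z)"
  let ?L = "lin_tangent (Suc (Suc j)) (Suc j) (lin_tangent (Suc j) j (E_fst j))"
  have "lin_tangent (Suc (Suc j)) (Suc j) (E_fst (Suc j)) (lift_rep j A z)
      = lin_tangent (Suc (Suc j)) (Suc j) (E_fst (Suc j) \<circ> E_flip j) (E_flip (Suc j) ?B)"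
    by (simp add: lift_rep_def lin_tangent_compose)
  also have "\<dots> = ?L (E_flip (Suc j) ?B)"
    by (rule lin_tangent_cong) (simp add: E_fst_E_flip)
  also have "\<dots> = E_flip j (?L ?B)"
    by (rule lin_tangent_tangent_E_flip) simp_all
  also have "?L ?B = E_flip j z"
    by (rule E_tangent_linear_section[OF W semispray_rep_maps bounded_linear_lin_tangent[OF bounded_linear_E_fst]
          semispray_rep_differentiable semispray_rep_lin_tangent z(2)])
  finally show ?thesis
    using z(1) by (simp add: E_flip_flip)
qed

text \<open>TTp T\<kappa> \<kappa> TA \<kappa> = T(Tp \<kappa>) \<kappa> TA \<kappa> = Tp \<kappa>
  TA \<kappa> = p TA \<kappa> = A p \<kappa> = A Tp.\<close>

lemma lift_rep_E_conn: "E_conn 2 j (lift_rep j A z) = A (E_conn 1 j z)"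
proof -
  let ?B = "E_tangent (Suc j) (Suc (Suc j)) A (E_flip j z)"
  have conn: "E_conn 1 j = lin_tangent (Suc j) j (E_fst j)"
      "E_conn 2 j = lin_tangent (Suc (Suc j)) (Suc j) (lin_tangent (Suc j) j (E_fst j))"
    by (simp_all add: numeral_2_eq_2 E_conn_Suc E_conn_0 del: E_conn.simps)
  have "E_conn 2 j (lift_rep j A z)
      = lin_tangent (Suc (Suc j)) (Suc j) (lin_tangent (Suc j) j (E_fst j) \<circ> E_flip j) (E_flip (Suc j) ?B)"
    by (simp add: conn lift_rep_def lin_tangent_compose)
  also have "\<dots> = lin_tangent (Suc (Suc j)) (Suc j) (E_fst (Suc j)) (E_flip (Suc j) ?B)"
    by (rule lin_tangent_cong) (simp add: lin_tangent_E_fst_E_flip)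
  also have "\<dots> = E_fst (Suc (Suc j)) ?B"
    by (rule lin_tangent_E_fst_E_flip) simp
  also have "\<dots> = A (E_fst (Suc j) (E_flip j z))"
    using z(2) semispray_rep_maps by (intro E_fst_E_tangent) (auto simp: tangent_set_def)
  also have "E_fst (Suc j) (E_flip j z) = E_conn 1 j z"
    unfolding conn(1) by (rule E_fst_E_flip[OF z(1)])
  finally show ?thesis .
qed

end

text \<open>The lift is a bounded linear map after TA after a flip, hence smooth; the remaining
  conditions are the two section identities above.\<close>

lemma semispray_rep_lift_rep:
  assumes V: "open_in (Suc (Suc j)) V" "E_flip j ` V \<subseteq> tangent_set (Suc j) W"
  shows "semispray_rep (Suc j) V (lift_rep j A)"
proof -
  let ?L = "\<lambda>z. lin_tangent (j + 2) (j + 2) (E_flip j) (E_flip (Suc j) z)"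
  have L: "bounded_linear ?L"
    by (rule bounded_linear_compose[OF bounded_linear_lin_tangent[OF bounded_linear_E_flip] bounded_linear_E_flip])
  have sm: "E_smooth_on (Suc (Suc j)) (Suc (Suc (Suc j))) V (E_tangent (Suc j) (Suc (Suc j)) A \<circ> E_flip j)"
    by (rule E_smooth_on_compose[OF V(1) open_in_tangent_set[OF W] V(2)
          E_smooth_on_linear[OF bounded_linear_E_flip V(1)] E_smooth_on_tangent[OF semispray_rep_smooth]])
  have "E_smooth_on (Suc (Suc j)) (Suc (Suc (Suc j))) V (?L \<circ> (E_tangent (Suc j) (Suc (Suc j)) A \<circ> E_flip j))"
    by (rule E_smooth_on_compose[OF V(1) openin_subtopology_self _ sm
          E_smooth_on_linear[OF L openin_subtopology_self]]) auto
  moreover have "?L \<circ> (E_tangent (Suc j) (Suc (Suc j)) A \<circ> E_flip j) = lift_rep j A"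
    by (rule ext) (simp add: lift_rep_def)
  ultimately have "E_smooth_on (Suc (Suc j)) (Suc (Suc (Suc j))) V (lift_rep j A)"
    by simp
  moreover have "lift_rep j A ` V \<subseteq> E_space (Suc (Suc (Suc j)))"
    by (auto simp: lift_rep_def)
  moreover have "E_fst (Suc (Suc j)) (lift_rep j A z) = z"
      "lin_tangent (Suc (Suc j)) (Suc j) (E_fst (Suc j)) (lift_rep j A z) = z" if "z \<in> V" for z
    using lift_rep_section lift_rep_semispray openin_imp_subset[OF V(1)] V(2) that by blast+
  ultimately show ?thesis
    by (simp add: semispray_rep_def)
qed

end

lemma lookup_E_flip_0: "Poly_Mapping.lookup (E_flip r z) 0 = Poly_Mapping.lookup z 0"
  by (simp add: E_flip_def lookup_E_pair lookup_E_fst)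

text \<open>All members of a coherent sequence share coordinate 0, so one condition decides whether
  all of them lie in the images of the charts induced by \<alpha>.\<close>

lemma lookup_E_conn_0: "Poly_Mapping.lookup (E_conn j i z) 0 = Poly_Mapping.lookup z 0"
  by (induction j arbitrary: z) (simp_all add: lookup_E_pair lookup_E_fst)

section \<open>Smoothness of projective limits of smooth maps\<close>

lemma tendsto_coordinatewise:
  fixes f :: "'a \<Rightarrow> 'b \<Rightarrow> 'c::topological_space"
  assumes "\<And>i. ((\<lambda>x. f x i) \<longlongrightarrow> l i) F"
  shows "(f \<longlongrightarrow> l) F"
proof -
  have "limitin (product_topology (\<lambda>i. euclidean) UNIV) f l F"
    using assms by (simp add: limitin_componentwise)
  then show ?thesis
    by (simp add: euclidean_product_topology)
qed

lemma has_vector_derivative_imp_quotient_tendsto: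
  assumes "(f has_vector_derivative f') (at 0)"
  shows "((\<lambda>t. (f t - f 0) /\<^sub>R t) \<longlongrightarrow> f') (at (0::real))"
proof -
  have "((\<lambda>t. norm (f t - f 0 - t *\<^sub>R f') / norm t) \<longlongrightarrow> 0) (at 0)"
    using assms by (simp add: has_vector_derivative_def has_derivative_at)
  moreover have "\<forall>\<^sub>F t in at 0. norm (f t - f 0 - t *\<^sub>R f') / norm t = norm ((f t - f 0) /\<^sub>R t - f')"
    unfolding eventually_at_filter
  proof (intro always_eventually allI impI)
    fix t :: real assume "t \<noteq> 0"
    then have "(f t - f 0) /\<^sub>R t - f' = (f t - f 0 - t *\<^sub>R f') /\<^sub>R t"
      by (simp add: algebra_simps)
    then show "norm (f t - f 0 - t *\<^sub>R f') / norm t = norm ((f t - f 0) /\<^sub>R t - f')"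
      by (simp add: divide_inverse mult.commute)
  qed
  ultimately have "((\<lambda>t. norm ((f t - f 0) /\<^sub>R t - f')) \<longlongrightarrow> 0) (at 0)"
    by (rule Lim_transform_eventually)
  then show ?thesis
    by (simp add: LIM_zero_iff tendsto_norm_zero_iff)
qed

text \<open>Continuity and convergence in the product topology are tested coordinate by coordinate,
  and coordinate \<open>i\<close> of the proposed derivative depends only on \<open>x i\<close> and
  the \<open>h j i\<close>.\<close>

lemma frechet_smooth_on_limit:
  fixes A :: "nat \<Rightarrow> (nat \<Rightarrow>\<^sub>0 'e::real_normed_vector) \<Rightarrow> (nat \<Rightarrow>\<^sub>0 'f::real_normed_vector)"
  assumes V: "\<And>i. open_in (r i) (V i)" and A: "\<And>i. E_smooth_on (r i) (s i) (V i) (A i)" "\<And>i. A i ` V i \<subseteq> E_space (s i)"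
    and F: "\<And>x i. x \<in> F \<Longrightarrow> x i \<in> E_space (r i)" and W: "\<And>x i. x \<in> W \<Longrightarrow> x i \<in> V i"
    and f: "\<And>x i. x \<in> W \<Longrightarrow> f x i = A i (x i)"
  shows "frechet_smooth_on F W f"
  unfolding frechet_smooth_on_def
proof (intro exI[of _ "\<lambda>k x h i. dir_deriv k (r i) (s i) (A i) (x i) (\<lambda>j. h j i)"] conjI ballI allI impI)
  fix x h assume "x \<in> W"
  then show "(\<lambda>i. dir_deriv 0 (r i) (s i) (A i) (x i) (\<lambda>j. h j i)) = f x"
    using f by auto
next
  fix k
  have "continuous_on (W \<times> {h. range h \<subseteq> F})
      (\<lambda>z. dir_deriv k (r i) (s i) (A i) (fst z i) (\<lambda>j. snd z j i))" for i
  proof (rule continuous_on_dir_deriv[OF V A(1)])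
    show "continuous_on (W \<times> {h. range h \<subseteq> F}) (\<lambda>z. fst z i)"
      by (rule continuous_on_product_then_coordinatewise[OF continuous_on_fst[OF continuous_on_id]])
    show "continuous_on (W \<times> {h. range h \<subseteq> F}) (\<lambda>z. snd z j i)" for j
      by (rule continuous_on_product_then_coordinatewise[OF
            continuous_on_product_then_coordinatewise[OF continuous_on_snd[OF continuous_on_id]]])
  qed (use W F in auto)
  then show "continuous_on (W \<times> {h. range h \<subseteq> F})
      (\<lambda>(x, h) i. dir_deriv k (r i) (s i) (A i) (x i) (\<lambda>j. h j i))"
    unfolding case_prod_unfold by (rule continuous_on_coordinatewise_then_product)
next
  fix k :: nat and x and h :: "nat \<Rightarrow> nat \<Rightarrow> nat \<Rightarrow>\<^sub>0 'e"
  assume x: "x \<in> W" and h: "range h \<subseteq> F"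
  show "((\<lambda>t i. (dir_deriv k (r i) (s i) (A i) (x i + t *\<^sub>R h k i) (\<lambda>j. h j i)
          - dir_deriv k (r i) (s i) (A i) (x i) (\<lambda>j. h j i)) /\<^sub>R t)
      \<longlongrightarrow> (\<lambda>i. dir_deriv (Suc k) (r i) (s i) (A i) (x i) (\<lambda>j. h j i))) (at (0::real))"
  proof (rule tendsto_coordinatewise)
    fix i
    have "range (\<lambda>j. h j i) \<subseteq> E_space (r i)"
      using h F by auto
    from has_vector_derivative_imp_quotient_tendsto[OF dir_deriv_has_vector_derivative[OF V A W[OF x] this, of k]]
    show "((\<lambda>t. (dir_deriv k (r i) (s i) (A i) (x i + t *\<^sub>R h k i) (\<lambda>j. h j i)
          - dir_deriv k (r i) (s i) (A i) (x i) (\<lambda>j. h j i)) /\<^sub>R t)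
      \<longlongrightarrow> dir_deriv (Suc k) (r i) (s i) (A i) (x i) (\<lambda>j. h j i)) (at 0)"
      by simp
  qed
qed

section \<open>The iterated lifts of a semispray\<close>

context iterated_tangent_bundles
begin

abbreviation cimage :: "nat \<Rightarrow> 'i \<Rightarrow> (nat \<Rightarrow>\<^sub>0 'e) set" where
  "cimage r \<alpha> \<equiv> chart (TB M r) \<alpha> ` cdom (TB M r) \<alpha>"

lemma open_in_cimage: "\<alpha> \<in> index M \<Longrightarrow> open_in r (cimage r \<alpha>)"
  using TB.open_chart_image by simp

lemma cdom_Suc_iff: "\<xi> \<in> points (TB M (Suc r)) \<Longrightarrow> \<alpha> \<in> index M \<Longrightarrow> \<xi> \<in> cdom (TB M (Suc r)) \<alpha> \<longleftrightarrow> foot \<xi> \<in> cdom (TB M r) \<alpha>"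
  using TB.cdom_TN_iff by (simp add: TB.simps)

lemma cdom_subset_points: "\<alpha> \<in> index M \<Longrightarrow> \<xi> \<in> cdom (TB M r) \<alpha> \<Longrightarrow> \<xi> \<in> points (TB M r)"
  using TB.points_eq[of r] by auto

lemma points_cases:
  assumes "\<xi> \<in> points (TB M r)"
  obtains \<alpha> where "\<alpha> \<in> index M" "\<xi> \<in> cdom (TB M r) \<alpha>"
  using assms TB.points_eq[of r] by auto

lemma chart_eqD:
  assumes "\<alpha> \<in> index M" "\<xi> \<in> cdom (TB M r) \<alpha>" "\<eta> \<in> cdom (TB M r) \<alpha>" "chart (TB M r) \<alpha> \<xi> = chart (TB M r) \<alpha> \<eta>"
  shows "\<xi> = \<eta>"
  using TB.inj_chart[of \<alpha> r] assms by (simp add: inj_onD)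

context
  fixes S assumes S: "semispray M 1 S"
begin

definition lift_reps :: "nat \<Rightarrow> 'i \<Rightarrow> (nat \<Rightarrow>\<^sub>0 'e) \<Rightarrow> (nat \<Rightarrow>\<^sub>0 'e)" where
  "lift_reps j \<alpha> = rec_nat (chart (TB M 2) \<alpha> \<circ> S \<circ> chart_inv (TB M 1) \<alpha>) lift_rep j"

lemma lift_reps_0: "lift_reps 0 \<alpha> = chart (TB M 2) \<alpha> \<circ> S \<circ> chart_inv (TB M 1) \<alpha>"
  and lift_reps_Suc: "lift_reps (Suc j) \<alpha> = lift_rep j (lift_reps j \<alpha>)"
  by (simp_all add: lift_reps_def)

section \<open>The given semispray and its lifts in a single chart\<close>

lemma semispray_foot: "\<xi> \<in> points (TB M 1) \<Longrightarrow> foot (S \<xi>) = \<xi>"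
  and semispray_kappa: "\<xi> \<in> points (TB M 1) \<Longrightarrow> kappa M 2 (S \<xi>) = S \<xi>"
  and semispray_points: "\<xi> \<in> points (TB M 1) \<Longrightarrow> S \<xi> \<in> points (TB M 2)"
  and semispray_smooth: "smooth_map_wrt (E_smooth_on 1 2) (TB M 1) (TB M 2) S"
  using S by (auto simp: semispray_def vector_field_def smooth_map_wrt_def numeral_2_eq_2)

text \<open>S \<xi> has foot \<xi>, and the foot decides the chart domain. This is why one chart of
  M can serve for source and target.\<close>

lemma semispray_cdom: "\<alpha> \<in> index M \<Longrightarrow> \<xi> \<in> cdom (TB M 1) \<alpha> \<Longrightarrow> S \<xi> \<in> cdom (TB M 2) \<alpha>"
  using cdom_Suc_iff[of "S \<xi>" 1 \<alpha>] semispray_points semispray_foot cdom_subset_points[of \<alpha> \<xi> 1] by (simp add: numeral_2_eq_2)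

lemma reps_semispray: "reps 1 2 S (lift_reps 0)"
  unfolding represents_def using semispray_cdom TB.chart_inv_chart[of _ 1] by (simp add: lift_reps_0)

text \<open>Smoothness of \<open>S\<close> provides, near each point, only some pair of charts
  \<beta>, \<gamma>. The representative in \<alpha> is obtained there by composing with the
  transitions \<alpha> to \<beta> and \<gamma> to \<alpha>, and smoothness is a local
  property.\<close>

lemma lift_reps_0_smooth:
  assumes \<alpha>: "\<alpha> \<in> index M"
  shows "E_smooth_on 1 2 (cimage 1 \<alpha>) (lift_reps 0 \<alpha>)"
proof (rule E_smooth_on_local)
  fix x assume "x \<in> cimage 1 \<alpha>"
  then obtain p where "x = chart (TB M 1) \<alpha> p" "p \<in> cdom (TB M 1) \<alpha>"
    by (rule imageE)
  note p = this(2,1)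
  obtain \<beta> \<gamma> W where \<beta>: "\<beta> \<in> index M" and \<gamma>: "\<gamma> \<in> index M" and p\<beta>: "p \<in> cdom (TB M 1) \<beta>"
    and W: "open_in 1 W" "chart (TB M 1) \<beta> p \<in> W" "W \<subseteq> cimage 1 \<beta>"
    and SW: "S ` chart_inv (TB M 1) \<beta> ` W \<subseteq> cdom (TB M 2) \<gamma>"
    and sm: "E_smooth_on 1 2 W (chart (TB M 2) \<gamma> \<circ> S \<circ> chart_inv (TB M 1) \<beta>)"
    using semispray_smooth cdom_subset_points[OF \<alpha> p(1)] unfolding smooth_map_wrt_def TB.model_eq index_TB by blast
  let ?t1 = "TB.transition 1 \<alpha> \<beta>" and ?t2 = "TB.transition 2 \<gamma> \<alpha>"
  let ?S = "chart (TB M 2) \<gamma> \<circ> S \<circ> chart_inv (TB M 1) \<beta>"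
  define U where "U = {y \<in> TB.overlap 1 \<alpha> \<beta>. ?t1 y \<in> W}"
  have t1: "E_smooth_on 1 1 (TB.overlap 1 \<alpha> \<beta>) ?t1"
    using TB.smooth_transition[of \<alpha> 1 \<beta>] \<alpha> \<beta> by simp
  have ov: "open_in 1 (TB.overlap 1 \<alpha> \<beta>)"
    using TB.open_overlap[of \<alpha> 1 \<beta>] \<alpha> \<beta> by simp
  have "openin (top_of_set (TB.overlap 1 \<alpha> \<beta>)) U"
    unfolding U_def using TB.transition_maps_space[of \<alpha> 1 \<beta>] \<alpha> \<beta>
    by (intro open_in_vimage[OF W(1) E_smooth_on_continuous[OF t1]]) simp
  then have U: "open_in 1 U"
    using ov openin_trans by blast
  have xU: "x \<in> U"
    using p p\<beta> W(2) TB.chart_inv_chart[of \<alpha> 1 p] \<alpha> by (auto simp: U_def)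
  have "E_smooth_on 1 2 U (?S \<circ> ?t1)"
    by (rule E_smooth_on_compose[OF U W(1) _ E_smooth_on_subset[OF _ t1] sm]) (auto simp: U_def)
  moreover have "(?S \<circ> ?t1) ` U \<subseteq> TB.overlap 2 \<gamma> \<alpha>"
  proof (clarify)
    fix y assume "y \<in> U"
    then obtain q where q: "q \<in> cdom (TB M 1) \<alpha>" "q \<in> cdom (TB M 1) \<beta>" "y = chart (TB M 1) \<alpha> q" "?t1 y \<in> W"
      by (auto simp: U_def)
    then have t: "?t1 y = chart (TB M 1) \<beta> q" "chart_inv (TB M 1) \<beta> (?t1 y) = q"
      using TB.chart_inv_chart[of \<alpha> 1 q] TB.chart_inv_chart[of \<beta> 1 q] \<alpha> \<beta> by auto
    have "S q \<in> cdom (TB M 2) \<gamma>"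
      using SW q(4) t(2) by force
    \<comment> \<open>The second transition needs S q in both domains: \<open>SW\<close> gives
      \<gamma>, the section property gives \<alpha>.\<close>
    moreover have "S q \<in> cdom (TB M 2) \<alpha>"
      by (rule semispray_cdom[OF \<alpha> q(1)])
    ultimately show "(?S \<circ> ?t1) y \<in> TB.overlap 2 \<gamma> \<alpha>"
      using t(2) by simp
  qed
  moreover have "E_smooth_on 2 2 (TB.overlap 2 \<gamma> \<alpha>) ?t2" "open_in 2 (TB.overlap 2 \<gamma> \<alpha>)"
    using TB.smooth_transition[of \<gamma> 2 \<alpha>] TB.open_overlap[of \<gamma> 2 \<alpha>] \<alpha> \<gamma> by simp_all
  ultimately have "E_smooth_on 1 2 U (?t2 \<circ> (?S \<circ> ?t1))"
    using E_smooth_on_compose[OF U] by blast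
  then have "E_smooth_on 1 2 U (lift_reps 0 \<alpha>)"
  proof (rule E_smooth_on_cong[OF U, rotated])
    fix y assume "y \<in> U"
    then obtain q where q: "q \<in> cdom (TB M 1) \<alpha>" "q \<in> cdom (TB M 1) \<beta>" "y = chart (TB M 1) \<alpha> q" "?t1 y \<in> W"
      by (auto simp: U_def)
    then have t: "chart_inv (TB M 1) \<alpha> y = q" "chart_inv (TB M 1) \<beta> (chart (TB M 1) \<beta> q) = q"
      using TB.chart_inv_chart[of \<alpha> 1 q] TB.chart_inv_chart[of \<beta> 1 q] \<alpha> \<beta> by auto
    then have "chart (TB M 1) \<beta> q \<in> W"
      using q(4) by simp
    then have "S q \<in> cdom (TB M 2) \<gamma>"
      using SW t(2) by force
    then show "(?t2 \<circ> (?S \<circ> ?t1)) y = lift_reps 0 \<alpha> y"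
      using t TB.chart_inv_chart[of \<gamma> 2 "S q"] \<gamma> by (simp add: lift_reps_0)
  qed
  then show "\<exists>U. open_in 1 U \<and> x \<in> U \<and> E_smooth_on 1 2 U (lift_reps 0 \<alpha>)"
    using U xU by blast
qed

text \<open>Tp S = p \<kappa> S = p S = id, by p \<circ> \<kappa> = Tp and \<kappa> S = S.\<close>

lemma semispray_rep_0:
  assumes \<alpha>: "\<alpha> \<in> index M"
  shows "semispray_rep 0 (cimage 1 \<alpha>) (lift_reps 0 \<alpha>)"
proof -
  have "lift_reps 0 \<alpha> x \<in> E_space 2 \<and> E_fst 1 (lift_reps 0 \<alpha> x) = x \<and> lin_tangent 1 0 (E_fst 0) (lift_reps 0 \<alpha> x) = x"
    if x: "x \<in> cimage 1 \<alpha>" for x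
  proof -
    obtain p where p: "p \<in> cdom (TB M 1) \<alpha>" "x = chart (TB M 1) \<alpha> p"
      using x by blast
    have pp: "p \<in> points (TB M 1)"
      by (rule cdom_subset_points[OF \<alpha> p(1)])
    have Sp: "S p \<in> cdom (TB M 2) \<alpha>" "chart (TB M 2) \<alpha> (S p) = lift_reps 0 \<alpha> x"
      using representsD[OF reps_semispray, of \<alpha> p] \<alpha> p by simp_all
    have in2: "lift_reps 0 \<alpha> x \<in> E_space 2"
      using TB.chart_in[of \<alpha> 2 "S p"] Sp \<alpha> by simp
    have fst: "E_fst 1 (lift_reps 0 \<alpha> x) = x"
      using representsD(2)[OF reps_foot[of 1], of \<alpha> "S p"] Sp semispray_foot[OF pp] \<alpha> p(2) by (simp add: numeral_2_eq_2)
    have "E_flip 0 (lift_reps 0 \<alpha> x) = lift_reps 0 \<alpha> x"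
      using representsD(2)[OF reps_kappa[of 0], of \<alpha> "S p"] Sp semispray_kappa[OF pp] \<alpha> by (simp add: numeral_2_eq_2)
    then have "lin_tangent 1 0 (E_fst 0) (lift_reps 0 \<alpha> x) = E_fst 1 (lift_reps 0 \<alpha> x)"
      using E_fst_E_flip[of "lift_reps 0 \<alpha> x" 0] in2 by (simp add: numeral_2_eq_2)
    with in2 fst show ?thesis
      by simp
  qed
  then show ?thesis
    using lift_reps_0_smooth[OF \<alpha>] by (auto simp: semispray_rep_def numeral_2_eq_2)
qed

lemma E_flip_cimage:
  assumes "\<alpha> \<in> index M"
  shows "E_flip j ` cimage (Suc (Suc j)) \<alpha> \<subseteq> tangent_set (Suc j) (cimage (Suc j) \<alpha>)"
  using assms by (auto simp: chart_TB_image tangent_set_def lookup_E_flip_0 lookup_E_fst)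

lemma semispray_rep_lift_reps:
  assumes "\<alpha> \<in> index M"
  shows "semispray_rep j (cimage (Suc j) \<alpha>) (lift_reps j \<alpha>)"
proof (induction j)
  case 0
  show ?case
    using semispray_rep_0[OF assms] by simp
next
  case (Suc j)
  show ?case
    unfolding lift_reps_Suc
    by (rule semispray_rep_lift_rep[OF open_in_cimage[OF assms] Suc open_in_cimage[OF assms] E_flip_cimage[OF assms]])
qed

text \<open>\<open>represents_tmap\<close> asks for differentiable representatives; this is why
  \<open>semispray_rep_lift_reps\<close> comes first and is proved on the representatives
  alone.\<close>

lemma reps_iterated_lift: "reps (Suc j) (Suc (Suc j)) (iterated_lift M S j) (lift_reps j)"
proof (induction j)
  case 0
  show ?case
    using reps_semispray by (simp add: numeral_2_eq_2)
next
  case (Suc j)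
  note kappa1 = reps_kappa[of j] and kappa2 = reps_kappa[of "Suc j"]
  have "represents (tangent_bundle (Suc j) (TB M (Suc j))) (tangent_bundle (Suc (Suc j)) (TB M (Suc (Suc j))))
      (tmap (TB M (Suc j)) (TB M (Suc (Suc j))) (iterated_lift M S j))
      (\<lambda>\<alpha>. E_tangent (Suc j) (Suc (Suc j)) (lift_reps j \<alpha>))"
  proof (rule represents_tmap[OF E_manifold_TB E_manifold_TB _ Suc])
    show "lift_reps j \<alpha> differentiable at x within E_space (Suc j)"
      if "\<alpha> \<in> index (TB M (Suc j))" "x \<in> cimage (Suc j) \<alpha>" for \<alpha> x
      using semispray_rep_lift_reps[of \<alpha> j] that E_smooth_on_differentiable
      unfolding semispray_rep_def index_TB by blast
  qed simp
  then have DA: "reps (Suc (Suc j)) (Suc (Suc (Suc j))) (tmap (TB M (Suc j)) (TB M (Suc (Suc j))) (iterated_lift M S j))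
      (\<lambda>\<alpha>. E_tangent (Suc j) (Suc (Suc j)) (lift_reps j \<alpha>))"
    by (simp add: TB.simps)
  have Dkappa: "reps (Suc (Suc (Suc j))) (Suc (Suc (Suc j)))
      (tmap (TB M (Suc (Suc j))) (TB M (Suc (Suc j))) (kappa M (Suc (Suc j))))
      (\<lambda>_. lin_tangent (Suc (Suc j)) (Suc (Suc j)) (E_flip j))"
    by (rule reps_tmap_linear[OF kappa1 bounded_linear_E_flip])
  have "reps (Suc (Suc j)) (Suc (Suc (Suc j)))
      (tmap (TB M (Suc (Suc j))) (TB M (Suc (Suc j))) (kappa M (Suc (Suc j)))
        \<circ> (kappa M (Suc (Suc (Suc j)))
        \<circ> (tmap (TB M (Suc j)) (TB M (Suc (Suc j))) (iterated_lift M S j) \<circ> kappa M (Suc (Suc j)))))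
      (\<lambda>\<alpha>. lin_tangent (Suc (Suc j)) (Suc (Suc j)) (E_flip j) \<circ>
        (E_flip (Suc j) \<circ> (E_tangent (Suc j) (Suc (Suc j)) (lift_reps j \<alpha>) \<circ> E_flip j)))"
    by (intro represents_compose[OF represents_compose[OF represents_compose[OF kappa1 DA] kappa2] Dkappa]) simp_all
  moreover have "lin_tangent (Suc (Suc j)) (Suc (Suc j)) (E_flip j) \<circ>
        (E_flip (Suc j) \<circ> (E_tangent (Suc j) (Suc (Suc j)) (lift_reps j \<alpha>) \<circ> E_flip j)) = lift_reps (Suc j) \<alpha>" for \<alpha>
    by (rule ext) (simp add: lift_reps_Suc lift_rep_def)
  moreover have "iterated_lift M S (Suc j)
      = tmap (TB M (Suc (Suc j))) (TB M (Suc (Suc j))) (kappa M (Suc (Suc j)))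
        \<circ> (kappa M (Suc (Suc (Suc j)))
        \<circ> (tmap (TB M (Suc j)) (TB M (Suc (Suc j))) (iterated_lift M S j) \<circ> kappa M (Suc (Suc j))))"
    by (rule ext) (simp add: complete_lift_def del: kappa.simps)
  ultimately show ?case
    by (simp only:)
qed

section \<open>The limit semispray\<close>

lemma chart_T_infinity: "chart (T_infinity M j) \<alpha> \<xi> i = chart (TB M (i + j)) \<alpha> (\<xi> i)"
  by (simp add: T_infinity_def)

text \<open>All components of a coherent sequence lie over the same point of M, so a chart around
  the first one works for every component.\<close>

lemma points_T_infinity:
  assumes "\<xi> \<in> points (T_infinity M 1)"
  obtains \<alpha> where "\<alpha> \<in> index M" "\<xi> \<in> cdom (T_infinity M 1) \<alpha>"
proof -
  have pts: "\<xi> i \<in> points (TB M (Suc i))" and conn: "conn M 1 i (\<xi> (Suc i)) = \<xi> i" for i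
    using assms by (auto simp: T_infinity_def)
  obtain \<alpha> where \<alpha>: "\<alpha> \<in> index M" "\<xi> 0 \<in> cdom (TB M 1) \<alpha>"
    using points_cases[OF pts[of 0]] by auto
  have "\<xi> i \<in> cdom (TB M (Suc i)) \<alpha>" for i
  proof (induction i)
    case (Suc i)
    \<comment> \<open>A tangent map covers its base map, and for \<open>conn M 1 i\<close> that base
      map is again \<open>foot\<close>.\<close>
    have "foot (foot (\<xi> (Suc i))) = foot (\<xi> i)"
      unfolding conn[of i, symmetric] by (simp add: tmap_def)
    moreover have "foot (\<xi> i) \<in> cdom (TB M i) \<alpha>"
      using Suc cdom_Suc_iff[OF pts \<alpha>(1)] by simp
    moreover have "foot (\<xi> (Suc i)) \<in> points (TB M (Suc i))"
      using points_cases[OF pts[of "Suc i"]] representsD(1)[OF reps_foot] cdom_subset_points by (metis index_TB)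
    ultimately show ?case
      using cdom_Suc_iff[OF pts \<alpha>(1)] cdom_Suc_iff \<alpha>(1) by simp
  qed (use \<alpha> in simp)
  with \<alpha>(1) conn show thesis
    by (intro that) (auto simp: T_infinity_def)
qed

text \<open>Coherence propagates the condition on coordinate 0 from the first component to all
  others, so infinitely many open conditions collapse to one.\<close>

lemma chart_T_infinity_image:
  assumes \<alpha>: "\<alpha> \<in> index M"
  shows "chart (T_infinity M 1) \<alpha> ` cdom (T_infinity M 1) \<alpha>
    = {x \<in> model (T_infinity M 1). Poly_Mapping.lookup (x 0) 0 \<in> chart M \<alpha> ` cdom M \<alpha>}" (is "_ = ?R")
proof (intro subset_antisym subsetI)
  fix x assume "x \<in> chart (T_infinity M 1) \<alpha> ` cdom (T_infinity M 1) \<alpha>"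
  then obtain \<xi> where \<xi>: "\<And>i. \<xi> i \<in> cdom (TB M (i + 1)) \<alpha>" "\<And>i. conn M 1 i (\<xi> (Suc i)) = \<xi> i"
    and x: "x = (\<lambda>i. chart (TB M (i + 1)) \<alpha> (\<xi> i))"
    by (auto simp: T_infinity_def)
  have "E_conn 1 i (x (Suc i)) = x i" for i
    using representsD(2)[OF reps_conn[of i 1], of \<alpha> "\<xi> (Suc i)"] \<xi>(1)[of "Suc i"] \<alpha> \<xi>(2)[of i]
    by (simp add: x del: E_conn.simps conn.simps)
  moreover have "x i \<in> cimage (i + 1) \<alpha>" for i
    using \<xi>(1)[of i] by (simp add: x)
  ultimately show "x \<in> ?R"
    using chart_TB_image[OF \<alpha>] by (auto simp: T_infinity_def simp del: E_conn.simps)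
next
  fix x assume "x \<in> ?R"
  then have x: "\<And>i. x i \<in> E_space (i + 1)" "\<And>i. E_conn 1 i (x (Suc i)) = x i"
    and x0: "Poly_Mapping.lookup (x 0) 0 \<in> chart M \<alpha> ` cdom M \<alpha>"
    by (auto simp: T_infinity_def simp del: E_conn.simps)
  have lookup: "Poly_Mapping.lookup (x i) 0 = Poly_Mapping.lookup (x 0) 0" for i
    by (induction i) (metis, metis x(2) lookup_E_conn_0)
  have "x i \<in> cimage (i + 1) \<alpha>" for i
    unfolding chart_TB_image[OF \<alpha>] using x(1)[of i] x0 lookup[of i] by simp
  then have "\<forall>i. \<exists>\<xi>. \<xi> \<in> cdom (TB M (i + 1)) \<alpha> \<and> chart (TB M (i + 1)) \<alpha> \<xi> = x i"
    by (metis imageE)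
  then obtain \<xi> where \<xi>: "\<And>i. \<xi> i \<in> cdom (TB M (i + 1)) \<alpha>" "\<And>i. chart (TB M (i + 1)) \<alpha> (\<xi> i) = x i"
    by metis
  \<comment> \<open>The \<xi> i were chosen independently of each other; they are coherent because
    their coordinates are and the chart is injective.\<close>
  have "conn M 1 i (\<xi> (Suc i)) = \<xi> i" for i
    using representsD[OF reps_conn[of i 1], of \<alpha> "\<xi> (Suc i)"] \<xi>(1)[of "Suc i"] \<xi>(1)[of i] \<alpha> \<xi>(2) x(2)
    by (intro chart_eqD[OF \<alpha>, of _ "i + 1"]) (simp_all del: E_conn.simps conn.simps)
  with \<xi> have "\<xi> \<in> cdom (T_infinity M 1) \<alpha>" "x = chart (T_infinity M 1) \<alpha> \<xi>"
    by (auto simp: T_infinity_def simp del: conn.simps)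
  then show "x \<in> chart (T_infinity M 1) \<alpha> ` cdom (T_infinity M 1) \<alpha>"
    by blast
qed

text \<open>By the previous lemma the image is the trace on the model space of the preimage of one
  open set under one continuous coordinate map.\<close>

lemma open_chart_T_infinity_image:
  assumes \<alpha>: "\<alpha> \<in> index M"
  shows "openin (top_of_set (model (T_infinity M 1))) (chart (T_infinity M 1) \<alpha> ` cdom (T_infinity M 1) \<alpha>)"
proof -
  have "open (chart M \<alpha> ` cdom M \<alpha>)"
    using banach_manifold \<alpha> unfolding banach_manifold_def by (metis Int_absorb)
  moreover have "continuous_on UNIV (\<lambda>x :: nat \<Rightarrow> nat \<Rightarrow>\<^sub>0 'e. Poly_Mapping.lookup (x 0) 0)"
    by (intro continuous_on_compose2[OF linear_continuous_on[OF bounded_linear_lookup]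
        continuous_on_product_coordinates]) auto
  ultimately have "open ((\<lambda>x :: nat \<Rightarrow> nat \<Rightarrow>\<^sub>0 'e. Poly_Mapping.lookup (x 0) 0) -` (chart M \<alpha> ` cdom M \<alpha>))"
    by (rule open_vimage)
  then show ?thesis
    unfolding chart_T_infinity_image[OF \<alpha>] openin_open by blast
qed

section \<open>Transfer of the coordinate identities to points\<close>

lemma iterated_lift_chart:
  assumes "\<alpha> \<in> index M" "\<xi> \<in> cdom (TB M (Suc i)) \<alpha>"
  shows "iterated_lift M S i \<xi> \<in> cdom (TB M (Suc (Suc i))) \<alpha>"
    and "chart (TB M (Suc (Suc i))) \<alpha> (iterated_lift M S i \<xi>) = lift_reps i \<alpha> (chart (TB M (Suc i)) \<alpha> \<xi>)"
  using representsD[OF reps_iterated_lift] assms by simp_all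

lemma foot_iterated_lift:
  assumes \<alpha>: "\<alpha> \<in> index M" and \<xi>: "\<xi> \<in> cdom (TB M (Suc i)) \<alpha>"
  shows "foot (iterated_lift M S i \<xi>) = \<xi>"
proof (rule chart_eqD[OF \<alpha> _ \<xi>])
  show "foot (iterated_lift M S i \<xi>) \<in> cdom (TB M (Suc i)) \<alpha>"
    using representsD(1)[OF reps_foot] iterated_lift_chart[OF assms] \<alpha> by simp
  have "lift_reps i \<alpha> (chart (TB M (Suc i)) \<alpha> \<xi>) \<in> E_space (Suc (Suc i))
      \<and> E_fst (Suc i) (lift_reps i \<alpha> (chart (TB M (Suc i)) \<alpha> \<xi>)) = chart (TB M (Suc i)) \<alpha> \<xi>"
    using semispray_rep_lift_reps[OF \<alpha>, of i] \<xi> by (auto simp: semispray_rep_def)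
  then show "chart (TB M (Suc i)) \<alpha> (foot (iterated_lift M S i \<xi>)) = chart (TB M (Suc i)) \<alpha> \<xi>"
    using representsD(2)[OF reps_foot] iterated_lift_chart[OF assms] \<alpha> by simp
qed

lemma conn_1_iterated_lift:
  assumes \<alpha>: "\<alpha> \<in> index M" and \<xi>: "\<xi> \<in> cdom (TB M (Suc i)) \<alpha>"
  shows "conn M 1 i (iterated_lift M S i \<xi>) = \<xi>"
proof (rule chart_eqD[OF \<alpha> _ \<xi>])
  note lift = iterated_lift_chart[OF assms]
  show "conn M 1 i (iterated_lift M S i \<xi>) \<in> cdom (TB M (Suc i)) \<alpha>"
    using representsD(1)[OF reps_conn[of i 1], of \<alpha>] lift \<alpha> by (simp del: conn.simps)
  have "E_conn 1 i (lift_reps i \<alpha> (chart (TB M (Suc i)) \<alpha> \<xi>)) = chart (TB M (Suc i)) \<alpha> \<xi>"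
    using semispray_rep_lift_reps[OF \<alpha>, of i] \<xi>
    by (simp add: semispray_rep_def E_conn_Suc E_conn_0 del: E_conn.simps)
  then show "chart (TB M (Suc i)) \<alpha> (conn M 1 i (iterated_lift M S i \<xi>)) = chart (TB M (Suc i)) \<alpha> \<xi>"
    using representsD(2)[OF reps_conn[of i 1], of \<alpha>] lift \<alpha> by (simp del: conn.simps E_conn.simps)
qed

text \<open>TTp \<circ> A\<circ>-lift = A \<circ> Tp on points, from \<open>lift_rep_E_conn\<close>:
  it puts the image of a coherent sequence into the second tangent bundle of the limit.\<close>

lemma conn_2_iterated_lift:
  assumes \<alpha>: "\<alpha> \<in> index M" and \<xi>: "\<xi> \<in> cdom (TB M (Suc (Suc i))) \<alpha>"
  shows "conn M 2 i (iterated_lift M S (Suc i) \<xi>) = iterated_lift M S i (conn M 1 i \<xi>)"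
proof (rule chart_eqD[OF \<alpha>])
  let ?x = "chart (TB M (Suc (Suc i))) \<alpha> \<xi>"
  note lift = iterated_lift_chart[OF assms]
  have conn1: "conn M 1 i \<xi> \<in> cdom (TB M (Suc i)) \<alpha>" "chart (TB M (Suc i)) \<alpha> (conn M 1 i \<xi>) = E_conn 1 i ?x"
    using representsD[OF reps_conn[of i 1], of \<alpha> \<xi>] \<alpha> \<xi> by (simp_all del: conn.simps E_conn.simps)
  have x: "?x \<in> cimage (Suc (Suc i)) \<alpha>"
    using \<xi> by simp
  have conn2: "conn M 2 i (iterated_lift M S (Suc i) \<xi>) \<in> cdom (TB M (Suc (Suc i))) \<alpha>"
    "chart (TB M (Suc (Suc i))) \<alpha> (conn M 2 i (iterated_lift M S (Suc i) \<xi>)) = E_conn 2 i (lift_reps (Suc i) \<alpha> ?x)"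
    using representsD[OF reps_conn[of i 2], of \<alpha> "iterated_lift M S (Suc i) \<xi>"] lift \<alpha>
    by (simp_all add: numeral_2_eq_2 del: conn.simps E_conn.simps iterated_lift.simps)
  show "conn M 2 i (iterated_lift M S (Suc i) \<xi>) \<in> cdom (TB M (Suc (Suc i))) \<alpha>"
    by (rule conn2)
  show "iterated_lift M S i (conn M 1 i \<xi>) \<in> cdom (TB M (Suc (Suc i))) \<alpha>"
    by (rule iterated_lift_chart[OF \<alpha> conn1(1)])
  have "E_conn 2 i (lift_reps (Suc i) \<alpha> ?x) = lift_reps i \<alpha> (E_conn 1 i ?x)"
    unfolding lift_reps_Suc
  proof (rule lift_rep_E_conn[OF open_in_cimage[OF \<alpha>] semispray_rep_lift_reps[OF \<alpha>]])
    show "?x \<in> E_space (Suc (Suc i))"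
      using x chart_TB_image[OF \<alpha>] by blast
    show "E_flip i ?x \<in> tangent_set (Suc i) (cimage (Suc i) \<alpha>)"
      using E_flip_cimage[OF \<alpha>] x by blast
  qed
  then show "chart (TB M (Suc (Suc i))) \<alpha> (conn M 2 i (iterated_lift M S (Suc i) \<xi>))
      = chart (TB M (Suc (Suc i))) \<alpha> (iterated_lift M S i (conn M 1 i \<xi>))"
    using conn1 conn2 iterated_lift_chart(2)[OF \<alpha> conn1(1)] by simp
qed

lemma lift_infinity_cdom:
  assumes \<alpha>: "\<alpha> \<in> index M" and \<xi>: "\<xi> \<in> cdom (T_infinity M 1) \<alpha>"
  shows "lift_infinity M S \<xi> \<in> cdom (T_infinity M 2) \<alpha>"
proof -
  have cd: "\<xi> i \<in> cdom (TB M (Suc i)) \<alpha>" and conn: "conn M 1 i (\<xi> (Suc i)) = \<xi> i" for i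
    using \<xi> by (auto simp: T_infinity_def simp del: conn.simps)
  show ?thesis
    using iterated_lift_chart(1)[OF \<alpha> cd] conn_2_iterated_lift[OF \<alpha> cd] conn
    by (simp add: T_infinity_def lift_infinity_def numeral_2_eq_2 del: conn.simps iterated_lift.simps)
qed

lemma smooth_lift_infinity:
  "smooth_map_wrt (frechet_smooth_on (model (T_infinity M 1))) (T_infinity M 1) (T_infinity M 2) (lift_infinity M S)"
  unfolding smooth_map_wrt_def
proof (intro ballI conjI)
  fix p assume "p \<in> points (T_infinity M 1)"
  then obtain \<alpha> where \<alpha>: "\<alpha> \<in> index M" "p \<in> cdom (T_infinity M 1) \<alpha>"
    by (rule points_T_infinity)
  let ?N = "T_infinity M 1" and ?P = "T_infinity M 2"
  let ?W = "chart ?N \<alpha> ` cdom ?N \<alpha>"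
  show "lift_infinity M S p \<in> points ?P"
    using lift_infinity_cdom[OF \<alpha>] cdom_subset_points[OF \<alpha>(1)] by (auto simp: T_infinity_def)
  have inv: "chart_inv ?N \<alpha> x \<in> cdom ?N \<alpha>" "chart ?N \<alpha> (chart_inv ?N \<alpha> x) = x" if "x \<in> ?W" for x
    using that by (simp_all add: chart_inv_def inv_into_into f_inv_into_f)
  have "frechet_smooth_on (model ?N) ?W (chart ?P \<alpha> \<circ> lift_infinity M S \<circ> chart_inv ?N \<alpha>)"
  proof (rule frechet_smooth_on_limit[where r = Suc and s = "\<lambda>i. Suc (Suc i)"
        and V = "\<lambda>i. cimage (Suc i) \<alpha>" and A = "\<lambda>i. lift_reps i \<alpha>"])
    show "open_in (Suc i) (cimage (Suc i) \<alpha>)" for i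
      by (rule open_in_cimage[OF \<alpha>(1)])
    show "E_smooth_on (Suc i) (Suc (Suc i)) (cimage (Suc i) \<alpha>) (lift_reps i \<alpha>)"
      "lift_reps i \<alpha> ` cimage (Suc i) \<alpha> \<subseteq> E_space (Suc (Suc i))" for i
      using semispray_rep_lift_reps[OF \<alpha>(1), of i] by (simp_all add: semispray_rep_def)
    show "x i \<in> E_space (Suc i)" if "x \<in> model ?N" for x i
      using that by (simp add: T_infinity_def)
    fix x i assume x: "x \<in> ?W"
    define \<xi> where "\<xi> = chart_inv ?N \<alpha> x"
    have \<xi>: "\<xi> i \<in> cdom (TB M (Suc i)) \<alpha>"
      using inv(1)[OF x] by (simp add: \<xi>_def T_infinity_def)
    have xi: "x i = chart (TB M (Suc i)) \<alpha> (\<xi> i)"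
      using fun_cong[OF inv(2)[OF x], of i] by (simp add: \<xi>_def chart_T_infinity)
    show "x i \<in> cimage (Suc i) \<alpha>"
      using \<xi> xi by simp
    show "(chart ?P \<alpha> \<circ> lift_infinity M S \<circ> chart_inv ?N \<alpha>) x i = lift_reps i \<alpha> (x i)"
      using iterated_lift_chart(2)[OF \<alpha>(1) \<xi>] xi
      unfolding comp_apply chart_T_infinity lift_infinity_def \<xi>_def[symmetric] by simp
  qed
  moreover have "lift_infinity M S ` chart_inv ?N \<alpha> ` ?W \<subseteq> cdom ?P \<alpha>"
    using inv(1) lift_infinity_cdom[OF \<alpha>(1)] by blast
  ultimately show "\<exists>\<alpha>\<in>index ?N. \<exists>\<beta>\<in>index ?P. \<exists>W. p \<in> cdom ?N \<alpha> \<and> openin (top_of_set (model ?N)) W \<and>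
      chart ?N \<alpha> p \<in> W \<and> W \<subseteq> chart ?N \<alpha> ` cdom ?N \<alpha> \<and>
      lift_infinity M S ` chart_inv ?N \<alpha> ` W \<subseteq> cdom ?P \<beta> \<and>
      frechet_smooth_on (model ?N) W (chart ?P \<beta> \<circ> lift_infinity M S \<circ> chart_inv ?N \<alpha>)"
    \<comment> \<open>The whole chart image serves as \<open>W\<close>, and \<alpha> as the chart on
      both sides.\<close>
    using \<alpha> open_chart_T_infinity_image[OF \<alpha>(1)]
    by (intro bexI[of _ \<alpha>] exI[of _ ?W]) (auto simp: T_infinity_def)
qed

lemma semispray_lift_infinity: "semispray_T_infinity M (lift_infinity M S)"
  unfolding semispray_T_infinity_def vector_field_TT_infinity_def
proof (intro conjI smooth_lift_infinity ballI ext)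
  fix \<xi> i assume "\<xi> \<in> points (T_infinity M 1)"
  then obtain \<alpha> where \<alpha>: "\<alpha> \<in> index M" "\<xi> \<in> cdom (T_infinity M 1) \<alpha>"
    by (rule points_T_infinity)
  then have \<xi>: "\<xi> i \<in> cdom (TB M (Suc i)) \<alpha>"
    by (simp add: T_infinity_def)
  show "foot (lift_infinity M S \<xi> i) = \<xi> i"
    using foot_iterated_lift[OF \<alpha>(1) \<xi>] by (simp add: lift_infinity_def)
  show "tmap (TB M (i + 1)) (TB M i) foot (lift_infinity M S \<xi> i) = \<xi> i"
    using conn_1_iterated_lift[OF \<alpha>(1) \<xi>] by (simp add: lift_infinity_def)
qed

end

end

theorem proposition3p10:
  fixes M :: "('a, 'i, 'e::banach) mfd"
    and S :: "('a, 'i, nat \<Rightarrow>\<^sub>0 'e) tpoint \<Rightarrow> ('a, 'i, nat \<Rightarrow>\<^sub>0 'e) tpoint"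
  assumes "banach_manifold M"
    and "partitionable M"
    and "semispray M 1 S"
  shows "semispray_T_infinity M (lift_infinity M S)"
proof -
  interpret iterated_tangent_bundles M
    by unfold_locales (rule assms(1))
  show ?thesis
    by (rule semispray_lift_infinity[OF assms(3)])
qed

end
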